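(* Let $\mathcal{O}_{-11}=\mathbb{Z}[\omega]$, $\omega=(-1+\sqrt{-11})/2$, and let $p$ be an odd rational prime which splits in $\mathcal{O}_{-11}$, $p=\pi\overline{\pi}$, with $\pi=a+b\omega$, $a,b\in\mathbb{Z}$, $a\ge 0$, $b>0$. Let $\mathrm{P}\Gamma=\mathrm{P}\Gamma_0(\pi)\subset\mathrm{PSL}_2(\mathcal{O}_{-11})$ be the congruence subgroup of elements with lower left entry in $\langle\pi\rangle$. Let $\mathcal{S}_{\langle\pi\rangle}$ be the collection consisting of the spheres of radius $1/\sqrt p$ centered at $\alpha/\pi$ for $\alpha\in\mathcal{O}_{-11}\setminus\langle\pi\rangle$, together with the isometric spheres (of radius $1/\sqrt{3p}$) of $\begin{pmatrix}1&0\\ \omega\pi&1\end{pmatrix}$, $\begin{pmatrix}1&0\\(\omega+1)\pi&1\end{pmatrix}$ and their inverses, and the translates of these by $\mathrm{P}\Gamma_\infty$. Then: (1) The spheres of $\mathcal{S}_{\langle\pi\rangle}$ suffice to determine the boundary of the region $B$ exterior to all isometric spheres of $\mathrm{P}\Gamma_0(\pi)$, i.e. $B$ is the region exterior to all spheres of $\mathcal{S}_{\langle\pi\rangle}$. (2) A Ford fundamental domain for $\mathrm{P}\Gamma_0(\pi)$ is given by the union of the hyperbolic convex hull of the cusps $0$, $\infty$ and the points of $\mathbb{H}^3$ above $\pm z_1/\pi,\pm z_2/\pi,\pm z_3/\pi$ at height $\sqrt{2/(11p)}$, and of the following convex hulls: for each integer $j$ with $-(p-1)/2\le j\le (p-1)/2$,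 the convex hull of $\infty$ and the points above $(j\pm z_1)/\pi$, $(j\pm z_2)/\pi$, $(j\pm z_3)/\pi$ at height $\sqrt{2/(11p)}$.
   Context: $\mathbb{H}^3$ is upper half-space over $\mathbb{C}$. For $\gamma=\begin{pmatrix}a&b\\c&d\end{pmatrix}\in\mathrm{PSL}_2(\mathbb{C})$ with $c\neq0$, the isometric sphere $S_\gamma$ is the hemisphere with center $-d/c$ and radius $1/|c|$. For a discrete group $\mathrm{P}\Gamma$, $\mathrm{P}\Gamma_\infty$ is the subgroup of elements fixing $\infty$; a Ford fundamental domain for $\mathrm{P}\Gamma$ is the intersection of the region $B\subset\mathbb{H}^3$ exterior to all isometric spheres of elements of $\mathrm{P}\Gamma$ with a fundamental domain for the action of $\mathrm{P}\Gamma_\infty$. $z_1=\frac{3}{11}+\frac{6\omega}{11}=\frac{3i}{\sqrt{11}}$, $z_2=-\frac{3}{11}+\frac{5\omega}{11}=-\frac12+\frac{5i}{2\sqrt{11}}$, $z_3=\frac{8}{11}+\frac{5\omega}{11}=\frac12+\frac{5i}{2\sqrt{11}}$. *)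

theory Defs
  imports "HOL-Analysis.Analysis" "HOL-Algebra.Ideal_Product"
begin

section \<open>The ring of integers \<open>\<int>[\<omega>]\<close> of \<open>\<rat>(\<surd>-11)\<close>\<close>

definition omega :: complex where
  "omega = (- 1 + \<i> * complex_of_real (sqrt 11)) / 2"

text \<open>Since \<open>\<omega>\<^sup>2 = - \<omega> - 3\<close> (lemma \<open>omega_square\<close> below), the ring \<open>\<int>[\<omega>]\<close> is \<open>\<int> + \<int>\<omega>\<close>.\<close>

definition O11 :: "complex ring" where
  "O11 = \<lparr>carrier = {of_int x + of_int y * omega | x y :: int. True},
          mult = (*), one = 1, zero = 0, add = (+)\<rparr>"

definition splits_in_O11 :: "nat \<Rightarrow> bool" where
  "splits_in_O11 p \<longleftrightarrow>
     (\<exists>P Q. primeideal P O11 \<and> primeideal Q O11 \<and> P \<noteq> Q \<and>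
            PIdl\<^bsub>O11\<^esub> (of_nat p) = ideal_prod O11 P Q)"

lemma omega_square: "omega\<^sup>2 = - omega - 3"
proof -
  have "(complex_of_real (sqrt 11))\<^sup>2 = 11"
    by (simp flip: of_real_power)
  then show ?thesis
    by (simp add: omega_def power2_eq_square field_simps)
qed

lemma O11I: "u = of_int x + of_int y * omega \<Longrightarrow> u \<in> carrier O11"
  by (auto simp: O11_def)

lemma O11_ops:
  "x \<oplus>\<^bsub>O11\<^esub> y = x + y" "x \<otimes>\<^bsub>O11\<^esub> y = x * y" "\<zero>\<^bsub>O11\<^esub> = 0" "\<one>\<^bsub>O11\<^esub> = 1"
  by (simp_all add: O11_def)

lemma cring_O11: "cring O11"
proof (rule cringI)
  show "abelian_group O11"
  proof (rule abelian_groupI)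
    fix x y assume "x \<in> carrier O11" "y \<in> carrier O11"
    then obtain a b c d :: int where
      "x = of_int a + of_int b * omega" "y = of_int c + of_int d * omega"
      by (auto simp: O11_def)
    then have "x + y = of_int (a + c) + of_int (b + d) * omega"
      by (simp add: algebra_simps)
    then show "x \<oplus>\<^bsub>O11\<^esub> y \<in> carrier O11"
      unfolding O11_ops by (rule O11I)
  next
    have "0 = of_int 0 + of_int 0 * omega" by simp
    then show "\<zero>\<^bsub>O11\<^esub> \<in> carrier O11"
      unfolding O11_ops by (rule O11I)
  next
    fix x assume "x \<in> carrier O11"
    then obtain a b :: int where "x = of_int a + of_int b * omega"
      by (auto simp: O11_def)
    then have "of_int (- a) + of_int (- b) * omega + x = 0"
      by simp
    then show "\<exists>y\<in>carrier O11. y \<oplus>\<^bsub>O11\<^esub> x = \<zero>\<^bsub>O11\<^esub>"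
      unfolding O11_ops using O11I[OF refl, of "- a" "- b"] by blast
  qed (auto simp: O11_def)
  show "Group.comm_monoid O11"
  proof (rule Group.comm_monoidI)
    fix x y assume "x \<in> carrier O11" "y \<in> carrier O11"
    then obtain a b c d :: int where
      xy: "x = of_int a + of_int b * omega" "y = of_int c + of_int d * omega"
      by (auto simp: O11_def)
    have "x * y = of_int (a * c) + of_int (a * d + b * c) * omega + of_int (b * d) * omega\<^sup>2"
      unfolding xy by (simp add: algebra_simps power2_eq_square)
    also have "\<dots> = of_int (a * c - 3 * b * d) + of_int (a * d + b * c - b * d) * omega"
      unfolding omega_square by (simp add: algebra_simps)
    finally show "x \<otimes>\<^bsub>O11\<^esub> y \<in> carrier O11"
      unfolding O11_ops by (rule O11I)
  next
    have "1 = of_int 1 + of_int 0 * omega" by simp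
    then show "\<one>\<^bsub>O11\<^esub> \<in> carrier O11"
      unfolding O11_ops by (rule O11I)
  qed (auto simp: O11_def)
qed (auto simp: O11_def algebra_simps)


section \<open>Upper half-space\<close>

definition H3 :: "(complex \<times> real) set" where
  "H3 = {(z, t). t > 0}"

text \<open>
  Elements of \<open>PSL\<^sub>2(\<complex>)\<close> are given by representatives in \<open>SL\<^sub>2(\<complex>)\<close>. The representatives
  \<open>A\<close> and \<open>-A\<close> have the same action and the same isometric sphere (lemmas \<open>act_uminus\<close> and
  \<open>isometric_sphere_uminus\<close> below), and all notions here depend on the matrices only through
  these.

  The action is the Poincare extension of the Moebius transformation
  \<open>z \<mapsto> (a z + b) / (c z + d)\<close>.
\<close>

definition act :: "complex^2^2 \<Rightarrow> complex \<times> real \<Rightarrow> complex \<times> real" where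
  "act A = (\<lambda>(z, t).
     let a = A$1$1; b = A$1$2; c = A$2$1; d = A$2$2;
         N = (norm (c * z + d))\<^sup>2 + (norm c)\<^sup>2 * t\<^sup>2
     in (((a * z + b) * cnj (c * z + d) + a * cnj c * complex_of_real (t\<^sup>2)) / complex_of_real N,
         t / N))"

definition hemisphere :: "complex \<Rightarrow> real \<Rightarrow> (complex \<times> real) set" where
  "hemisphere m r = sphere (m, 0) r \<inter> H3"

text \<open>Only meaningful if the lower left entry is nonzero.\<close>

definition isometric_sphere :: "complex^2^2 \<Rightarrow> (complex \<times> real) set" where
  "isometric_sphere A = hemisphere (- (A$2$2) / A$2$1) (1 / norm (A$2$1))"

lemma act_uminus: "act (- A) = act A"
proof -
  have "norm (- (c * z) - d) = norm (c * z + d)" for c z d :: complex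
    by (metis minus_add_distrib norm_minus_cancel uminus_add_conv_diff add.commute)
  then show ?thesis
    by (auto simp: act_def Let_def algebra_simps)
qed

lemma isometric_sphere_uminus: "isometric_sphere (- A) = isometric_sphere A"
  by (simp add: isometric_sphere_def)

text \<open>
  The points of \<open>H3\<close> on or outside every hemisphere of a collection. The exterior is
  taken to be closed, so that Ford domains are closed sets containing their faces.
\<close>

definition exterior :: "(complex \<times> real) set set \<Rightarrow> (complex \<times> real) set" where
  "exterior \<Sigma> = {x \<in> H3. \<forall>m r. r > 0 \<and> hemisphere m r \<in> \<Sigma> \<longrightarrow> r \<le> dist x (m, 0)}"


section \<open>Ford fundamental domains\<close>

text \<open>A matrix fixes \<open>\<infinity>\<close> iff its lower left entry vanishes.\<close>

definition stab_infinity :: "(complex^2^2) set \<Rightarrow> (complex^2^2) set" where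
  "stab_infinity \<Gamma> = {A \<in> \<Gamma>. A$2$1 = 0}"

definition fundamental_domain :: "(complex^2^2) set \<Rightarrow> (complex \<times> real) set \<Rightarrow> bool" where
  "fundamental_domain \<Gamma> D \<longleftrightarrow>
     closedin (top_of_set H3) D \<and>
     (\<forall>x\<in>H3. \<exists>A\<in>\<Gamma>. act A x \<in> D) \<and>
     (\<forall>x\<in>interior D. \<forall>A\<in>\<Gamma>. act A x \<in> interior D \<longrightarrow> act A x = x) \<and>
     negligible (frontier D \<inter> H3)"

definition ford_region :: "(complex^2^2) set \<Rightarrow> (complex \<times> real) set" where
  "ford_region \<Gamma> = exterior (isometric_sphere ` (\<Gamma> - stab_infinity \<Gamma>))"

definition ford_fundamental_domain :: "(complex^2^2) set \<Rightarrow> (complex \<times> real) set \<Rightarrow> bool" where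
  "ford_fundamental_domain \<Gamma> F \<longleftrightarrow>
     (\<exists>D. fundamental_domain (stab_infinity \<Gamma>) D \<and> F = ford_region \<Gamma> \<inter> D)"


section \<open>Hyperbolic convex hulls\<close>

text \<open>
  Points of the closure of upper half-space: \<open>Pt z t\<close> with \<open>t > 0\<close> is the point
  of \<open>H3\<close> above \<open>z\<close> at height \<open>t\<close>, and \<open>Pt z 0\<close> and \<open>Infinity\<close> are the ideal points.
\<close>

datatype hpoint = Pt complex real | Infinity

text \<open>
  The geodesic segment (ray, line) between two points, endpoints included. Its supporting
  geodesic is a vertical line, or, over distinct points \<open>z\<close>, \<open>w\<close> of the plane, the semicircle
  in the vertical plane through \<open>z\<close> and \<open>w\<close> that passes through both points and is centered on
  the boundary plane, at \<open>m\<close>.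
\<close>

fun geodesic_segment :: "hpoint \<Rightarrow> hpoint \<Rightarrow> hpoint set" where
  "geodesic_segment (Pt z t) (Pt w u) =
     (if z = w then {Pt z s | s. s \<in> closed_segment t u}
      else {Pt x s | x s. x \<in> closed_segment z w \<and> s \<ge> 0 \<and>
              (\<exists>m \<in> affine hull {z, w}.
                 dist (x, s) (m, 0) = dist (z, t) (m, 0) \<and>
                 dist (w, u) (m, 0) = dist (z, t) (m, 0))})"
| "geodesic_segment (Pt z t) Infinity = insert Infinity {Pt z s | s. s \<ge> t}"
| "geodesic_segment Infinity (Pt z t) = insert Infinity {Pt z s | s. s \<ge> t}"
| "geodesic_segment Infinity Infinity = {Infinity}"

definition hyp_convex :: "hpoint set \<Rightarrow> bool" where
  "hyp_convex C \<longleftrightarrow> (\<forall>x\<in>C. \<forall>y\<in>C. geodesic_segment x y \<subseteq> C)"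

definition hyp_convex_hull :: "hpoint set \<Rightarrow> (complex \<times> real) set" where
  "hyp_convex_hull X = {(z, t) \<in> H3. Pt z t \<in> hyp_convex hull X}"


section \<open>The congruence subgroup and its spheres\<close>

definition Gamma0 :: "complex \<Rightarrow> (complex^2^2) set" where
  "Gamma0 \<pi> = {A. det A = 1 \<and> (\<forall>i j. A$i$j \<in> carrier O11) \<and> A$2$1 \<in> PIdl\<^bsub>O11\<^esub> \<pi>}"

definition lower_unipotent :: "complex \<Rightarrow> complex^2^2" where
  "lower_unipotent c = vector [vector [1, 0], vector [c, 1]]"

definition sphere_collection :: "nat \<Rightarrow> complex \<Rightarrow> (complex \<times> real) set set" where
  "sphere_collection p \<pi> =
     (let M = {lower_unipotent (omega * \<pi>), lower_unipotent ((omega + 1) * \<pi>)};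
          base = {hemisphere (\<alpha> / \<pi>) (1 / sqrt (real p)) | \<alpha>.
                    \<alpha> \<in> carrier O11 - PIdl\<^bsub>O11\<^esub> \<pi>} \<union>
                 isometric_sphere ` (M \<union> matrix_inv ` M)
      in {act A ` S | A S. A \<in> stab_infinity (Gamma0 \<pi>) \<and> S \<in> base})"

definition z1 :: complex where "z1 = 3/11 + 6 * omega / 11"
definition z2 :: complex where "z2 = - 3/11 + 5 * omega / 11"
definition z3 :: complex where "z3 = 8/11 + 5 * omega / 11"

definition hexagon_vertices :: "nat \<Rightarrow> complex \<Rightarrow> int \<Rightarrow> hpoint set" where
  "hexagon_vertices p \<pi> j =
     {Pt ((of_int j + v) / \<pi>) (sqrt (2 / (11 * real p))) | v. v \<in> {z1, - z1, z2, - z2, z3, - z3}}"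

end

theory Submission
  imports Defs
begin

text \<open>
  In the coordinates \<open>(z, h)\<close> with \<open>h = (norm z)\<^sup>2 + t\<^sup>2\<close> (Klein model), geodesics become straight
  segments and the exterior of an isometric sphere becomes a half-space. Write \<open>w = \<pi> z\<close>. The
  plane of \<open>w\<close> is tiled by the Voronoi hexagons of the lattice \<open>\<int>[\<omega>]\<close>. For a matrix with bottom
  row \<open>(g \<pi>, d)\<close>, being exterior to its isometric sphere is an inequality \<open>1 \<le> L\<close> with \<open>L\<close> affine
  in the Klein coordinates. At the lifted corners of a hexagon \<open>L\<close> is the value of a positive
  definite Hermitian form that takes integral values, and at the cusp \<open>0\<close> it is
  \<open>(norm d)\<^sup>2\<close>, which is nonzero since the determinant is \<open>1\<close>. So \<open>1 \<le> L\<close> on every convex hull in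
  the theorem. Conversely, cutting a hexagon into triangles with two vertices at adjacent corners
  shows that a point above it and exterior to the spheres of the collection lies in the hull.
\<close>

section \<open>Hyperbolic convexity in Klein coordinates\<close>

definition klein :: "complex \<times> real \<Rightarrow> complex \<times> real" where
  "klein = (\<lambda>(z, t). (z, (norm z)\<^sup>2 + t\<^sup>2))"

lemma klein_Pair [simp]: "klein (z, t) = (z, (norm z)\<^sup>2 + t\<^sup>2)"
  by (simp add: klein_def)

lemma dist_boundary: "dist (z, t) (m, 0::real) = sqrt ((norm (z - m))\<^sup>2 + t\<^sup>2)" for z m :: complex
  by (simp add: dist_norm norm_Pair)

text \<open>After squaring, \<open>(norm m)\<^sup>2\<close> cancels, so being equidistant from a
  boundary point \<open>m\<close> is an affine condition in Klein coordinates.\<close>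

lemma dist_boundary_eq_iff:
  "dist (z, t) (m, 0::real) = dist (w, u) (m, 0) \<longleftrightarrow>
     (norm z)\<^sup>2 + t\<^sup>2 - 2 * (z \<bullet> m) = (norm w)\<^sup>2 + u\<^sup>2 - 2 * (w \<bullet> m)" for z w m :: complex
  unfolding dist_boundary
  by (simp add: power2_norm_eq_inner inner_diff_left inner_diff_right inner_commute) argo

text \<open>Keeps a Euclidean segment between Klein points on or above the paraboloid
  \<open>h = (norm z)\<^sup>2\<close>, so that it lifts back to real heights.\<close>

lemma norm_convex_combination_le:
  fixes z w :: complex
  assumes "0 \<le> u" "u \<le> 1"
  shows "(norm ((1 - u) *\<^sub>R z + u *\<^sub>R w))\<^sup>2 \<le> (1 - u) * (norm z)\<^sup>2 + u * (norm w)\<^sup>2"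
proof -
  have "(1 - u) * (norm z)\<^sup>2 + u * (norm w)\<^sup>2 - (norm ((1 - u) *\<^sub>R z + u *\<^sub>R w))\<^sup>2
      = u * (1 - u) * (norm (z - w))\<^sup>2"
    by (simp add: cmod_power2) (simp add: algebra_simps power2_eq_square)
  also have "\<dots> \<ge> 0" using assms by simp
  finally show ?thesis by simp
qed

lemma hyp_convexD: "hyp_convex C \<Longrightarrow> x \<in> C \<Longrightarrow> y \<in> C \<Longrightarrow> geodesic_segment x y \<subseteq> C"
  unfolding hyp_convex_def by blast

lemma hyp_convex_imp_convex_klein:
  assumes "hyp_convex C"
  shows "convex {(z, h). (norm z)\<^sup>2 \<le> h \<and> Pt z (sqrt (h - (norm z)\<^sup>2)) \<in> C}"
    (is "convex ?S")
  unfolding convex_alt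
proof (intro ballI allI impI)
  fix P Q :: "complex \<times> real" and u :: real
  assume "P \<in> ?S" "Q \<in> ?S" and u: "0 \<le> u \<and> u \<le> 1"
  then obtain z h w k where PQ: "P = (z, h)" "Q = (w, k)"
    and zh: "(norm z)\<^sup>2 \<le> h" "Pt z (sqrt (h - (norm z)\<^sup>2)) \<in> C"
    and wk: "(norm w)\<^sup>2 \<le> k" "Pt w (sqrt (k - (norm w)\<^sup>2)) \<in> C"
    by auto
  define x where "x = (1 - u) *\<^sub>R z + u *\<^sub>R w"
  define l where "l = (1 - u) * h + u * k"
  have "(1 - u) * (norm z)\<^sup>2 + u * (norm w)\<^sup>2 \<le> l"
    unfolding l_def using zh(1) wk(1) u by (intro add_mono mult_left_mono) auto
  then have lx: "(norm x)\<^sup>2 \<le> l"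
    using u norm_convex_combination_le[of u z w] by (auto simp: x_def)
  let ?s = "sqrt (l - (norm x)\<^sup>2)"
  have "Pt x ?s \<in> geodesic_segment (Pt z (sqrt (h - (norm z)\<^sup>2))) (Pt w (sqrt (k - (norm w)\<^sup>2)))"
  proof (cases "z = w")
    case True
    then have "x = z" by (simp add: x_def flip: scaleR_add_left)
    have "min h k \<le> l" "l \<le> max h k"
      using u convex_bound_le[of h "max h k" k "1 - u" u]
        convex_bound_le[of "- h" "- min h k" "- k" "1 - u" u]
      by (simp_all add: l_def)
    then have "?s \<in> closed_segment (sqrt (h - (norm z)\<^sup>2)) (sqrt (k - (norm w)\<^sup>2))"
      unfolding closed_segment_eq_real_ivl \<open>x = z\<close> True[symmetric]
      by (auto simp: min_def max_def split: if_splits)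
    then show ?thesis using True \<open>x = z\<close> by auto
  next
    case False
    \<comment> \<open>\<open>m\<close> is the center of the semicircle: the point of the line
      through \<open>z\<close> and \<open>w\<close> with
      \<open>2 * ((w - z) \<bullet> m) = k - h\<close>, hence equidistant from both
      endpoints.\<close>
    define \<mu> where "\<mu> = (k - h - 2 * ((w - z) \<bullet> z)) / (2 * (norm (w - z))\<^sup>2)"
    define m where "m = z + \<mu> *\<^sub>R (w - z)"
    have "m \<in> affine hull {z, w}"
      unfolding affine_hull_2 m_def
      by (rule CollectI, rule exI[of _ "1 - \<mu>"], rule exI[of _ \<mu>]) (simp add: algebra_simps)
    moreover have "2 * ((w - z) \<bullet> m) = k - h"
      using False by (simp add: m_def \<mu>_def inner_add_right power2_norm_eq_inner) (simp add: field_simps)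
    then have hk: "h - 2 * (z \<bullet> m) = k - 2 * (w \<bullet> m)" by (simp add: inner_diff_left)
    moreover have "l - 2 * (x \<bullet> m) = (1 - u) * (h - 2 * (z \<bullet> m)) + u * (k - 2 * (w \<bullet> m))"
      by (simp add: l_def x_def inner_add_left algebra_simps)
    then have "l - 2 * (x \<bullet> m) = h - 2 * (z \<bullet> m)" unfolding hk[symmetric] by (simp flip: distrib_right)
    moreover have "x \<in> closed_segment z w"
      using u by (auto simp: x_def closed_segment_def)
    ultimately show ?thesis
      using False lx zh(1) wk(1)
      by (auto simp: dist_boundary_eq_iff intro!: bexI[of _ m])
  qed
  then have "Pt x ?s \<in> C"
    by (rule subsetD[OF hyp_convexD[OF assms zh(2) wk(2)]])
  with lx show "(1 - u) *\<^sub>R P + u *\<^sub>R Q \<in> ?S"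
    by (simp add: PQ x_def l_def)
qed

text \<open>Along a semicircle centered at \<open>m\<close> the quantity
  \<open>h - 2 * (z \<bullet> m)\<close> is constant, so the Klein height is affine in the base
  point and the semicircle becomes a Euclidean segment. Upward closure of \<open>T\<close> takes
  care of the rays to \<open>Infinity\<close>.\<close>

lemma convex_klein_imp_hyp_convex:
  assumes "convex T" and up: "\<And>z h h'. (z, h) \<in> T \<Longrightarrow> h \<le> h' \<Longrightarrow> (z, h') \<in> T"
  shows "hyp_convex (insert Infinity {Pt z t | z t. t \<ge> 0 \<and> klein (z, t) \<in> T})" (is "hyp_convex ?C")
proof -
  have up': "Pt z s \<in> ?C" if "Pt z t \<in> ?C" "t \<le> s" for z t s
    using that by (auto intro: up)
  have seg: "geodesic_segment (Pt z t) (Pt w u) \<subseteq> ?C" if zw: "Pt z t \<in> ?C" "Pt w u \<in> ?C" for z t w u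
  proof (cases "z = w")
    case True
    then show ?thesis
      using up'[OF zw(1)] up'[OF zw(2)] by (auto simp: closed_segment_eq_real_ivl split: if_splits)
  next
    case False
    have "(x, (norm x)\<^sup>2 + s\<^sup>2) \<in> T"
      if x: "x \<in> closed_segment z w"
        and eq: "dist (x, s) (m, 0) = dist (z, t) (m, 0)" "dist (w, u) (m, 0) = dist (z, t) (m, 0)"
      for x s m
    proof -
      obtain l where l: "0 \<le> l" "l \<le> 1" "x = (1 - l) *\<^sub>R z + l *\<^sub>R w"
        using x by (auto simp: closed_segment_def)
      let ?h = "(norm z)\<^sup>2 + t\<^sup>2" and ?k = "(norm w)\<^sup>2 + u\<^sup>2"
      have "(norm x)\<^sup>2 + s\<^sup>2 = 2 * (x \<bullet> m) + ((1 - l) * (?h - 2 * (z \<bullet> m)) + l * (?k - 2 * (w \<bullet> m)))"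
      proof -
        have "?k - 2 * (w \<bullet> m) = ?h - 2 * (z \<bullet> m)" "(norm x)\<^sup>2 + s\<^sup>2 - 2 * (x \<bullet> m) = ?h - 2 * (z \<bullet> m)"
          using eq unfolding dist_boundary_eq_iff by simp_all
        then show ?thesis by (simp only:) (simp add: algebra_simps)
      qed
      also have "\<dots> = (1 - l) * ?h + l * ?k"
        by (simp add: l(3) inner_add_left algebra_simps)
      finally have x_eq: "(x, (norm x)\<^sup>2 + s\<^sup>2) = (1 - l) *\<^sub>R klein (z, t) + l *\<^sub>R klein (w, u)"
        using l(3) by simp
      have kl: "klein (z, t) \<in> T" "klein (w, u) \<in> T"
        using zw by simp_all
      have "(1 - l) *\<^sub>R klein (z, t) + l *\<^sub>R klein (w, u) \<in> T"
        by (rule convexD_alt[OF assms(1) kl l(1,2)])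
      with x_eq show ?thesis by argo
    qed
    with False show ?thesis by auto
  qed
  have ray: "geodesic_segment (Pt z t) Infinity \<subseteq> ?C" "geodesic_segment Infinity (Pt z t) \<subseteq> ?C"
    if "Pt z t \<in> ?C" for z t
    using up'[OF that] by auto
  show ?thesis
    unfolding hyp_convex_def
  proof (intro ballI)
    fix x y assume xy: "x \<in> ?C" "y \<in> ?C"
    show "geodesic_segment x y \<subseteq> ?C"
    proof (cases x; cases y)
      fix z t w u assume "x = Pt z t" "y = Pt w u" with seg xy show ?thesis by (simp only:)
    next
      fix z t assume "x = Pt z t" "y = Infinity" with ray xy show ?thesis by (simp only:)
    next
      fix z t assume "x = Infinity" "y = Pt z t" with ray xy show ?thesis by (simp only:)
    qed simp
  qed
qed

text \<open>The cusp \<open>Infinity\<close> adds to the Euclidean hull everything above it. This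
  upward closure is hyperbolically convex; conversely, a hyperbolically convex set containing the
  generators is convex in Klein coordinates and contains the vertical rays above its points.\<close>

lemma hyp_convex_hull_insert_Infinity:
  assumes "\<And>z t. (z, t) \<in> P \<Longrightarrow> t \<ge> 0"
  shows "hyp_convex_hull (insert Infinity ((\<lambda>(z, t). Pt z t) ` P)) =
    {(z, t) \<in> H3. \<exists>h \<le> (norm z)\<^sup>2 + t\<^sup>2. (z, h) \<in> convex hull (klein ` P)}"
    (is "hyp_convex_hull ?X = ?R")
proof -
  let ?Q = "convex hull (klein ` P)"
  define T where "T = {(z, h'). \<exists>h \<le> h'. (z, h) \<in> ?Q}"
  have T_iff: "(z, h) \<in> T \<longleftrightarrow> (\<exists>k\<le>h. (z, k) \<in> ?Q)" for z h
    by (auto simp: T_def)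
  have "convex T"
    unfolding convex_alt
  proof (safe, goal_cases)
    case (1 z h' w k' u)
    then obtain h k where hk: "h \<le> h'" "(z, h) \<in> ?Q" "k \<le> k'" "(w, k) \<in> ?Q"
      by (auto simp: T_iff)
    have "(1 - u) *\<^sub>R (z, h) + u *\<^sub>R (w, k) \<in> ?Q"
      using hk 1 convex_convex_hull[of "klein ` P"] unfolding convex_alt by blast
    moreover have "(1 - u) * h + u * k \<le> (1 - u) * h' + u * k'"
      using hk 1 by (simp add: add_mono mult_left_mono)
    ultimately show ?case by (auto simp: T_iff)
  qed
  then have "hyp_convex (insert Infinity {Pt z t | z t. t \<ge> 0 \<and> klein (z, t) \<in> T})"
    by (rule convex_klein_imp_hyp_convex) (auto simp: T_iff intro: order.trans)
  moreover have "klein x \<in> T" if "x \<in> P" for x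
    using hull_inc[OF imageI[OF that, of klein]] by (cases x) (auto simp: T_iff)
  then have "?X \<subseteq> insert Infinity {Pt z t | z t. t \<ge> 0 \<and> klein (z, t) \<in> T}"
    using assms by (auto simp del: klein_Pair)
  ultimately have "hyp_convex hull ?X \<subseteq> insert Infinity {Pt z t | z t. t \<ge> 0 \<and> klein (z, t) \<in> T}"
    by (intro hull_minimal)
  then have "hyp_convex_hull ?X \<subseteq> ?R"
    by (auto simp: hyp_convex_hull_def T_iff)
  moreover have "Pt z t \<in> C"
    if "hyp_convex C" "?X \<subseteq> C" "(z, h) \<in> ?Q" "h \<le> (norm z)\<^sup>2 + t\<^sup>2" "t > 0" for z t h C
  proof -
    have "klein ` P \<subseteq> {(z, h). (norm z)\<^sup>2 \<le> h \<and> Pt z (sqrt (h - (norm z)\<^sup>2)) \<in> C}"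
    proof (rule image_subsetI)
      fix x assume x: "x \<in> P"
      obtain z t where zt: "x = (z, t)" by fastforce
      then have "Pt z t \<in> C" "t \<ge> 0" using x that(2) assms by auto
      then show "klein x \<in> {(z, h). (norm z)\<^sup>2 \<le> h \<and> Pt z (sqrt (h - (norm z)\<^sup>2)) \<in> C}"
        by (simp add: zt)
    qed
    then have "?Q \<subseteq> {(z, h). (norm z)\<^sup>2 \<le> h \<and> Pt z (sqrt (h - (norm z)\<^sup>2)) \<in> C}"
      using hyp_convex_imp_convex_klein[OF that(1)] by (intro hull_minimal)
    then have "(norm z)\<^sup>2 \<le> h" "Pt z (sqrt (h - (norm z)\<^sup>2)) \<in> C"
      using that(3) by auto
    moreover have "sqrt (h - (norm z)\<^sup>2) \<le> t"
      using that by (intro real_le_lsqrt) auto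
    moreover have "Infinity \<in> C" using that(2) by auto
    moreover have "geodesic_segment (Pt z (sqrt (h - (norm z)\<^sup>2))) Infinity \<subseteq> C"
      using calculation by (intro hyp_convexD[OF that(1)])
    ultimately show ?thesis by auto
  qed
  then have "?R \<subseteq> hyp_convex_hull ?X"
    unfolding hyp_convex_hull_def hull_def H3_def by blast
  ultimately show ?thesis by blast
qed

section \<open>Arithmetic of \<open>\<int>[\<omega>]\<close>\<close>

lemma O11_cases:
  assumes "u \<in> carrier O11"
  obtains x y :: int where "u = of_int x + of_int y * omega"
  using assms by (auto simp: O11_def)

interpretation O11: cring O11
  rewrites "(\<otimes>\<^bsub>O11\<^esub>) = (*)" and "(\<oplus>\<^bsub>O11\<^esub>) = (+)" and "\<zero>\<^bsub>O11\<^esub> = 0" and "\<one>\<^bsub>O11\<^esub> = 1"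
  by (fact cring_O11) (simp_all add: O11_def)

lemma Re_omega [simp]: "Re omega = - 1 / 2" and Im_omega [simp]: "Im omega = sqrt 11 / 2"
  by (simp_all add: omega_def)

lemma sqrt_11_mult [simp]: "x * sqrt 11 * sqrt 11 = 11 * x" "sqrt 11 * (x * sqrt 11) = 11 * x"
  by simp_all

lemma of_int_O11 [simp]: "of_int n \<in> carrier O11"
  by (rule O11I[of _ n 0]) simp

lemma omega_O11 [simp]: "omega \<in> carrier O11"
  by (rule O11I[of _ 0 1]) simp

lemma uminus_O11 [simp]: "u \<in> carrier O11 \<Longrightarrow> - u \<in> carrier O11"
  using O11.m_closed[OF of_int_O11[of "- 1"], of u] by simp

lemma diff_O11 [simp]: "u \<in> carrier O11 \<Longrightarrow> v \<in> carrier O11 \<Longrightarrow> u - v \<in> carrier O11"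
  using O11.add.m_closed[of u "- v"] by simp

lemma cnj_omega: "cnj omega = - 1 - omega"
  by (simp add: complex_eq_iff)

lemma cnj_O11 [simp]:
  assumes "u \<in> carrier O11" shows "cnj u \<in> carrier O11"
proof -
  obtain x y where "u = of_int x + of_int y * omega" using assms by (rule O11_cases)
  then show ?thesis by (intro O11I[of _ "x - y" "- y"]) (simp add: cnj_omega algebra_simps)
qed

lemma norm_sq_O11: "(norm (of_int x + of_int y * omega))\<^sup>2 = of_int (x\<^sup>2 - x * y + 3 * y\<^sup>2)"
  by (simp add: cmod_power2) (simp add: power2_eq_square algebra_simps)

lemma norm_sq_O11_Ints [simp]: "u \<in> carrier O11 \<Longrightarrow> (norm u)\<^sup>2 \<in> \<int>"
  by (auto elim!: O11_cases simp: norm_sq_O11 simp del: of_int_add of_int_diff)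

lemma Ints_pos_ge_1: "x \<in> \<int> \<Longrightarrow> x > 0 \<Longrightarrow> x \<ge> (1 :: real)"
  by (auto elim!: Ints_cases)

lemma norm_sq_O11_ge_1: "u \<in> carrier O11 \<Longrightarrow> u \<noteq> 0 \<Longrightarrow> (norm u)\<^sup>2 \<ge> 1"
  by (rule Ints_pos_ge_1) auto

text \<open>Both factors have integral norm at least 1 and the norms multiply to 1; completing the
  square in the norm form then forces \<open>y = 0\<close>.\<close>

lemma O11_unit_cases:
  assumes "u \<in> carrier O11" "v \<in> carrier O11" "u * v = 1"
  shows "u = 1 \<or> u = - 1"
proof -
  obtain x y where u: "u = of_int x + of_int y * omega" using assms(1) by (rule O11_cases)
  have "(norm u)\<^sup>2 \<ge> 1" "(norm v)\<^sup>2 \<ge> 1"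
    using assms by (auto intro!: norm_sq_O11_ge_1)
  moreover have "(norm u)\<^sup>2 * (norm v)\<^sup>2 = 1"
    using assms(3) by (simp flip: power_mult_distrib norm_mult)
  moreover have "(norm u)\<^sup>2 * 1 \<le> (norm u)\<^sup>2 * (norm v)\<^sup>2"
    using calculation by (intro mult_left_mono) auto
  ultimately have "(norm u)\<^sup>2 = 1" by linarith
  then have "real_of_int (x\<^sup>2 - x * y + 3 * y\<^sup>2) = 1"
    unfolding u norm_sq_O11 .
  then have eq: "x\<^sup>2 - x * y + 3 * y\<^sup>2 = 1" by linarith
  then have "(2 * x - y)\<^sup>2 + 11 * y\<^sup>2 = 4" by (simp add: power2_eq_square algebra_simps)
  then have "11 * y\<^sup>2 \<le> 4" using zero_le_power2[of "2 * x - y"] by linarith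
  then have "y\<^sup>2 < 1" by linarith
  then have "y = 0" by (simp add: power_less_one_iff abs_square_less_1)
  with eq have "x = 1 \<or> x = - 1" by (simp add: power2_eq_1_iff)
  with \<open>y = 0\<close> u show ?thesis by auto
qed

text \<open>The vertices of the Voronoi cell of \<open>0\<close>; for example, \<open>z1\<close> is
  the circumcenter of \<open>0\<close>, \<open>omega\<close>, \<open>omega + 1\<close>. The squared
  circumradius is \<open>9/11\<close>, so the unit hemispheres about these lattice points meet above
  the corner at height \<open>sqrt (2/11)\<close>.\<close>

definition corners :: "complex set" where
  "corners = {z1, - z1, z2, - z2, z3, - z3}"

lemma Re_Im_z [simp]:
  "Re z1 = 0" "Im z1 = 3 * sqrt 11 / 11" "Re z2 = - 1 / 2" "Im z2 = 5 * sqrt 11 / 22"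
  "Re z3 = 1 / 2" "Im z3 = 5 * sqrt 11 / 22"
  by (simp_all add: z1_def z2_def z3_def)

lemma corners_uminus: "v \<in> corners \<Longrightarrow> - v \<in> corners"
  by (auto simp: corners_def)

lemma norm_sq_corners: "v \<in> corners \<Longrightarrow> (norm v)\<^sup>2 = 9 / 11"
  by (auto simp: corners_def cmod_power2 power_divide power_mult_distrib)

text \<open>The corners lie in the inverse different of \<open>\<int>[\<omega>]\<close>.\<close>

lemma trace_corners_Ints:
  assumes "v \<in> corners" "u \<in> carrier O11"
  shows "2 * Re (v * u) \<in> \<int>"
proof -
  obtain x y where u: "u = of_int x + of_int y * omega" using assms(2) by (rule O11_cases)
  have "2 * Re v \<in> \<int>" "2 * Re (v * omega) \<in> \<int>"
    using assms(1) by (auto simp: corners_def)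
  then have "real_of_int x * (2 * Re v) + of_int y * (2 * Re (v * omega)) \<in> \<int>"
    by (intro Ints_add Ints_mult[OF Ints_of_int])
  also have "of_int x * (2 * Re v) + of_int y * (2 * Re (v * omega)) = 2 * Re (v * u)"
    by (simp add: u algebra_simps)
  finally show ?thesis .
qed

lemma norm_sq_add: "(norm (x + y))\<^sup>2 = (norm x)\<^sup>2 + 2 * Re (x * cnj y) + (norm y)\<^sup>2"
  by (simp add: cmod_power2) (simp add: power2_eq_square algebra_simps)

text \<open>
  As \<open>(norm v)\<^sup>2 + 2/11 = 1\<close>, the left-hand side below is a positive definite Hermitian form
  with integral values.
\<close>

lemma corner_form_ge_1:
  assumes v: "v \<in> corners" and ge: "g \<in> carrier O11" "e \<in> carrier O11" "g \<noteq> 0"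
  shows "(norm (g * v + e))\<^sup>2 + (norm g)\<^sup>2 * (2 / 11) \<ge> 1"
proof (rule Ints_pos_ge_1)
  have "(norm (g * v + e))\<^sup>2 + (norm g)\<^sup>2 * (2 / 11) =
      (norm g)\<^sup>2 + 2 * Re (v * (g * cnj e)) + (norm e)\<^sup>2"
    unfolding norm_sq_add norm_mult power_mult_distrib norm_sq_corners[OF v]
    by (simp add: algebra_simps)
  also have "\<dots> \<in> \<int>"
    using ge by (intro Ints_add trace_corners_Ints[OF v] norm_sq_O11_Ints O11.m_closed cnj_O11)
  finally show "(norm (g * v + e))\<^sup>2 + (norm g)\<^sup>2 * (2 / 11) \<in> \<int>" .
  show "(norm (g * v + e))\<^sup>2 + (norm g)\<^sup>2 * (2 / 11) > 0"
    using ge(3) by (simp add: add_nonneg_pos)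
qed

section \<open>The Voronoi hexagon\<close>

text \<open>The inequalities say \<open>2 * (w \<bullet> u) \<le> (norm u)\<^sup>2\<close> for
  \<open>u\<close> among \<open>1\<close>, \<open>omega\<close>, \<open>omega + 1\<close> and their
  negatives: \<open>w\<close> is at least as close to \<open>0\<close> as to these
  neighbors.\<close>

definition hexagon :: "complex set" where
  "hexagon = {w. \<bar>Re w\<bar> \<le> 1 / 2 \<and> \<bar>Re w + sqrt 11 * Im w\<bar> \<le> 3 \<and> \<bar>sqrt 11 * Im w - Re w\<bar> \<le> 3}"

definition open_hexagon :: "complex set" where
  "open_hexagon = {w. \<bar>Re w\<bar> < 1 / 2 \<and> \<bar>Re w + sqrt 11 * Im w\<bar> < 3 \<and> \<bar>sqrt 11 * Im w - Re w\<bar> < 3}"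

lemma corners_subset_hexagon: "corners \<subseteq> hexagon"
  by (auto simp: corners_def hexagon_def)

lemma hexagon_uminus: "w \<in> hexagon \<Longrightarrow> - w \<in> hexagon"
  by (auto simp: hexagon_def)

lemma zero_in_hexagon: "0 \<in> hexagon"
  by (simp add: hexagon_def)

lemma convex_hexagon: "convex hexagon"
proof -
  have "hexagon = {w. 1 \<bullet> w \<le> 1 / 2} \<inter> {w. -1 \<bullet> w \<le> 1 / 2} \<inter>
      {w. Complex 1 (sqrt 11) \<bullet> w \<le> 3} \<inter> {w. Complex (-1) (- sqrt 11) \<bullet> w \<le> 3} \<inter>
      {w. Complex (-1) (sqrt 11) \<bullet> w \<le> 3} \<inter> {w. Complex 1 (- sqrt 11) \<bullet> w \<le> 3}"
    by (auto simp: hexagon_def inner_complex_def abs_le_iff)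
  also have "convex \<dots>"
    by (intro convex_Int convex_halfspace_le)
  finally show ?thesis .
qed

lemma closed_hexagon: "closed hexagon"
  unfolding hexagon_def by (intro closed_Collect_conj closed_Collect_le continuous_intros)

lemma open_open_hexagon: "open open_hexagon"
  unfolding open_hexagon_def by (intro open_Collect_conj open_Collect_less continuous_intros)

lemma open_hexagon_subset: "open_hexagon \<subseteq> hexagon"
  by (auto simp: open_hexagon_def hexagon_def)

lemma scale_in_open_hexagon:
  assumes "w \<in> hexagon" "0 \<le> c" "c < 1"
  shows "c *\<^sub>R w \<in> open_hexagon"
proof -
  have *: "\<bar>c * x\<bar> < r" if "\<bar>x\<bar> \<le> r" "r > 0" for x r :: real
  proof -
    have "\<bar>c * x\<bar> \<le> c * r" using that assms by (simp add: abs_mult mult_left_mono)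
    also have "\<dots> < r" using that assms by simp
    finally show ?thesis .
  qed
  show ?thesis
    using assms(1) *[of "Re w" "1 / 2"] *[of "Re w + sqrt 11 * Im w" 3] *[of "sqrt 11 * Im w - Re w" 3]
    by (simp add: hexagon_def open_hexagon_def algebra_simps)
qed

text \<open>Rounding to a row of the lattice and then within the row brings \<open>w - u0\<close>
  into a rectangle. Near the corners of the rectangle that stick out of the hexagon, one step to the
  neighbor across the violated edge repairs this.\<close>

lemma hexagon_cover:
  obtains u where "u \<in> carrier O11" "w - u \<in> hexagon"
proof -
  \<comment> \<open>Rows of the lattice are \<open>sqrt 11 / 2\<close> apart and row
    \<open>n\<close> is shifted by \<open>- n / 2\<close>, which the rounding in \<open>m\<close>
    compensates.\<close>
  define n where "n = round (2 / sqrt 11 * Im w)"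
  define m where "m = round (Re w + of_int n / 2)"
  define u0 where "u0 = of_int m + of_int n * omega"
  define x y where "x = Re (w - u0)" and "y = sqrt 11 * Im (w - u0)"
  have "\<bar>2 / sqrt 11 * Im w - of_int n\<bar> \<le> 1 / 2"
    unfolding n_def using of_int_round_abs_le[of "2 / sqrt 11 * Im w"] by linarith
  then have "11 / 2 * \<bar>2 / sqrt 11 * Im w - of_int n\<bar> \<le> 11 / 4" by simp
  also have "11 / 2 * \<bar>2 / sqrt 11 * Im w - of_int n\<bar> = \<bar>11 / 2 * (2 / sqrt 11 * Im w - of_int n)\<bar>"
    by (simp only: abs_mult)
  also have "11 / 2 * (2 / sqrt 11 * Im w - of_int n) = y"
    by (simp add: y_def u0_def field_simps)
  finally have y: "\<bar>y\<bar> \<le> 11 / 4" .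
  have "\<bar>Re w + of_int n / 2 - of_int m\<bar> \<le> 1 / 2"
    unfolding m_def using of_int_round_abs_le[of "Re w + of_int n / 2"] by linarith
  then have x: "\<bar>x\<bar> \<le> 1 / 2" by (simp add: x_def u0_def algebra_simps)
  have u0: "u0 \<in> carrier O11" unfolding u0_def by (rule O11I[OF refl])
  have hex: "w - (u0 + s) \<in> hexagon \<longleftrightarrow> \<bar>x - Re s\<bar> \<le> 1 / 2 \<and>
      \<bar>x - Re s + (y - sqrt 11 * Im s)\<bar> \<le> 3 \<and> \<bar>y - sqrt 11 * Im s - (x - Re s)\<bar> \<le> 3" for s
    by (simp add: hexagon_def x_def y_def algebra_simps)
  consider "\<bar>x + y\<bar> \<le> 3 \<and> \<bar>y - x\<bar> \<le> 3" | "x + y > 3" | "x + y < - 3" | "y - x > 3" | "y - x < - 3"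
    by linarith
  then have "\<exists>s\<in>{0, omega + 1, - omega - 1, omega, - omega}. w - (u0 + s) \<in> hexagon"
  proof cases
    case 1 then show ?thesis using x hex[of 0] by simp
  next
    case 2 then show ?thesis using x y hex[of "omega + 1"] by (intro bexI[of _ "omega + 1"]) auto
  next
    case 3 then show ?thesis using x y hex[of "- omega - 1"] by (intro bexI[of _ "- omega - 1"]) auto
  next
    case 4 then show ?thesis using x y hex[of omega] by (intro bexI[of _ omega]) auto
  next
    case 5 then show ?thesis using x y hex[of "- omega"] by (intro bexI[of _ "- omega"]) auto
  qed
  then obtain s where "s \<in> {0, omega + 1, - omega - 1, omega, - omega}" "w - (u0 + s) \<in> hexagon" by blast
  moreover from this(1) have "s \<in> carrier O11" by (auto intro!: diff_O11 uminus_O11)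
  ultimately show ?thesis using that[of "u0 + s"] u0 by simp
qed

lemma open_hexagon_disjoint:
  assumes "w \<in> open_hexagon" "w - u \<in> hexagon" "u \<in> carrier O11"
  shows "u = 0"
proof -
  obtain m n where u: "u = of_int m + of_int n * omega" using assms(3) by (rule O11_cases)
  \<comment> \<open>\<open>M / 2\<close> and \<open>11 * n / 2\<close> are the coordinates of
    \<open>u\<close> in the scaled system \<open>x\<close>, \<open>y\<close>; \<open>M\<close> has
    the parity of \<open>n\<close>.\<close>
  define M where "M = 2 * m - n"
  define x y where "x = Re w" and "y = sqrt 11 * Im w"
  have w: "\<bar>x\<bar> < 1 / 2" "\<bar>x + y\<bar> < 3" "\<bar>y - x\<bar> < 3"
    using assms(1) by (auto simp: open_hexagon_def x_def y_def)
  have wu: "\<bar>x - M / 2\<bar> \<le> 1 / 2" "\<bar>x - M / 2 + (y - 11 * n / 2)\<bar> \<le> 3"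
      "\<bar>y - 11 * n / 2 - (x - M / 2)\<bar> \<le> 3"
    using assms(2) by (auto simp: hexagon_def x_def y_def u M_def field_simps)
  have "\<bar>real_of_int M\<bar> < 2" "\<bar>real_of_int M + 11 * n\<bar> < 12" "\<bar>11 * real_of_int n - M\<bar> < 12"
    using w wu by linarith+
  then have "\<bar>M\<bar> < 2" "\<bar>M + 11 * n\<bar> < 12" "\<bar>11 * n - M\<bar> < 12"
    by linarith+
  then have "\<bar>M\<bar> < 2" "\<bar>11 * n\<bar> + \<bar>M\<bar> < 12" by linarith+
  moreover from this have "n = - 1 \<or> n = 0 \<or> n = 1" by linarith
  \<comment> \<open>For \<open>n = 1\<close> or \<open>n = - 1\<close> the bounds force
    \<open>M = 0\<close>, which has the wrong parity; for \<open>n = 0\<close>, \<open>M\<close> is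
    even with \<open>\<bar>M\<bar> < 2\<close>.\<close>
  ultimately have "n = 0 \<and> m = 0" unfolding M_def by (elim disjE; hypsubst; arith)
  then show ?thesis by (simp add: u)
qed

text \<open>The rays through the corners cut the hexagon into six triangles with apex
  \<open>0\<close>. In each, \<open>c + d\<close> is the term of the maximum that equals 1 on the
  outer edge; the bound on it controls the Klein height in the cell at the cusp
  \<open>0\<close>.\<close>

lemma hexagon_triangulation:
  assumes "w \<in> hexagon"
  obtains v v' c d where "v \<in> corners" "v' \<in> corners" "0 \<le> c" "0 \<le> d" "c + d \<le> 1"
    "w = c *\<^sub>R v + d *\<^sub>R v'"
    "c + d \<le> max (2 * \<bar>Re w\<bar>) (max (\<bar>Re w + sqrt 11 * Im w\<bar> / 3) (\<bar>sqrt 11 * Im w - Re w\<bar> / 3))"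
proof -
  define M where "M w = max (2 * \<bar>Re w\<bar>) (max (\<bar>Re w + sqrt 11 * Im w\<bar> / 3) (\<bar>sqrt 11 * Im w - Re w\<bar> / 3))"
    for w
  let ?P = "\<lambda>w v v' c d. v \<in> corners \<and> v' \<in> corners \<and> 0 \<le> c \<and> 0 \<le> d \<and> c + d \<le> 1 \<and>
    w = c *\<^sub>R v + d *\<^sub>R v' \<and> c + d \<le> M w"
  \<comment> \<open>By symmetry under negation three sectors suffice, one on the right and two on
    top. In the scaled coordinates the dividing rays lie on \<open>y = 5 * x\<close>,
    \<open>y = - 5 * x\<close> and the vertical axis.\<close>
  have half: "\<exists>v v' c d. ?P w v v' c d"
    if w: "w \<in> hexagon" and h: "\<bar>sqrt 11 * Im w\<bar> \<le> 5 * Re w \<or> 5 * \<bar>Re w\<bar> \<le> sqrt 11 * Im w" for w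
  proof -
    define x y where "x = Re w" and "y = sqrt 11 * Im w"
    have Imw: "Im w = sqrt 11 * y / 11" by (simp add: y_def)
    have xy: "\<bar>x\<bar> \<le> 1 / 2" "\<bar>x + y\<bar> \<le> 3" "\<bar>y - x\<bar> \<le> 3"
      using w by (auto simp: hexagon_def x_def y_def)
    from h consider "\<bar>y\<bar> \<le> 5 * x" | "5 * x \<le> y" "x \<ge> 0" | "- 5 * x \<le> y" "x \<le> 0"
      by (fold x_def y_def) linarith
    then show ?thesis
    proof cases
      case 1
      have "?P w z3 (- z2) (x + y / 5) (x - y / 5)"
        using 1 xy by (auto simp: complex_eq_iff corners_def Imw M_def simp flip: x_def) (auto simp: field_simps)
      then show ?thesis by blast
    next
      case 2
      have "?P w z3 z1 (2 * x) ((y - 5 * x) / 3)"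
        using 2 xy by (auto simp: complex_eq_iff corners_def Imw M_def simp flip: x_def) (auto simp: field_simps)
      then show ?thesis by blast
    next
      case 3
      have "?P w z2 z1 (- 2 * x) ((y + 5 * x) / 3)"
        using 3 xy by (auto simp: complex_eq_iff corners_def Imw M_def simp flip: x_def) (auto simp: field_simps)
      then show ?thesis by blast
    qed
  qed
  have "(\<bar>sqrt 11 * Im w\<bar> \<le> 5 * Re w \<or> 5 * \<bar>Re w\<bar> \<le> sqrt 11 * Im w) \<or>
      (\<bar>sqrt 11 * Im (- w)\<bar> \<le> 5 * Re (- w) \<or> 5 * \<bar>Re (- w)\<bar> \<le> sqrt 11 * Im (- w))"
    by simp linarith
  then have "(\<exists>v v' c d. ?P w v v' c d) \<or> (\<exists>v v' c d. ?P (- w) v v' c d)"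
    using half[of w] half[of "- w"] assms hexagon_uminus by blast
  moreover have "?P w (- v) (- v') c d" if "?P (- w) v v' c d" for v v' c d
  proof -
    have "w = - (c *\<^sub>R v + d *\<^sub>R v')" using that by (metis minus_minus)
    moreover have "\<bar>- Re w - sqrt 11 * Im w\<bar> = \<bar>Re w + sqrt 11 * Im w\<bar>"
      "\<bar>Re w - sqrt 11 * Im w\<bar> = \<bar>sqrt 11 * Im w - Re w\<bar>"
      by linarith+
    then have "M (- w) = M w" by (simp add: M_def)
    ultimately show ?thesis using that by (auto simp: corners_uminus)
  qed
  ultimately have "\<exists>v v' c d. ?P w v v' c d" by blast
  then show ?thesis using that unfolding M_def by blast
qed

section \<open>Isometric spheres and translations\<close>

lemma PIdl_O11_iff: "u \<in> PIdl\<^bsub>O11\<^esub> g \<longleftrightarrow> (\<exists>v\<in>carrier O11. u = v * g)"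
  by (auto simp: cgenideal_def O11_ops)

text \<open>The top point \<open>(m, r)\<close> of one hemisphere lies on the other, so
  \<open>r \<le> r'\<close>, and \<open>m = m'\<close> in case of equality. As
  \<open>exterior\<close> sees hemispheres only as sets, their centers and radii have to be
  recovered.\<close>

lemma hemisphere_inj:
  assumes "hemisphere m r = hemisphere m' r'" "r > 0" "r' > 0"
  shows "m = m' \<and> r = r'"
proof -
  have *: "r \<le> r' \<and> (r = r' \<longrightarrow> m = m')"
    if "hemisphere m r = hemisphere m' r'" "r > 0" "r' > 0" for m m' and r r'
  proof -
    have "(m, r) \<in> hemisphere m r"
      using that(2) by (simp add: hemisphere_def H3_def dist_boundary dist_commute[of "(m, 0)"])
    then have "(m, r) \<in> hemisphere m' r'" using that by simp
    then have "sqrt ((norm (m - m'))\<^sup>2 + r\<^sup>2) = r'"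
      by (simp add: hemisphere_def dist_boundary dist_commute[of "(m', 0)"])
    then have eq: "(norm (m - m'))\<^sup>2 + r\<^sup>2 = r'\<^sup>2"
      by (auto simp: real_sqrt_pow2)
    then have "r\<^sup>2 \<le> r'\<^sup>2" using zero_le_power2[of "norm (m - m')"] by linarith
    then have "r \<le> r'" by (rule power2_le_imp_le) (rule less_imp_le[OF that(3)])
    moreover have "m = m'" if "r = r'" using eq that by simp
    ultimately show ?thesis by blast
  qed
  from *[OF assms] *[OF assms(1)[symmetric] assms(3,2)] show ?thesis by auto
qed

lemma le_dist_boundary_iff:
  fixes z m :: complex
  assumes "r > 0"
  shows "r \<le> dist (z, t) (m, 0) \<longleftrightarrow> r\<^sup>2 \<le> (norm (z - m))\<^sup>2 + t\<^sup>2"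
  unfolding dist_boundary
  using assms power_mono[of r "sqrt ((norm (z - m))\<^sup>2 + t\<^sup>2)" 2] by (auto intro: real_le_rsqrt)

lemma in_exterior_iff:
  "(z, t) \<in> exterior \<Sigma> \<longleftrightarrow>
     t > 0 \<and> (\<forall>m r. r > 0 \<and> hemisphere m r \<in> \<Sigma> \<longrightarrow> r\<^sup>2 \<le> (norm (z - m))\<^sup>2 + t\<^sup>2)"
  by (auto simp: exterior_def H3_def le_dist_boundary_iff)

lemma isometric_sphere_le_iff:
  fixes c d z :: complex
  assumes "c \<noteq> 0"
  shows "(1 / norm c)\<^sup>2 \<le> (norm (z - (- d / c)))\<^sup>2 + t\<^sup>2 \<longleftrightarrow>
    1 \<le> (norm (c * z + d))\<^sup>2 + (norm c)\<^sup>2 * t\<^sup>2"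
proof -
  have "c * z + d = c * (z - (- d / c))" using assms by (simp add: field_simps)
  then have eq: "(norm (c * z + d))\<^sup>2 = (norm c)\<^sup>2 * (norm (z - (- d / c)))\<^sup>2"
    by (simp add: norm_mult power_mult_distrib)
  show ?thesis unfolding eq using assms by (simp add: field_simps power_divide)
qed

text \<open>Multiplying by \<open>(norm (A$2$1))\<^sup>2\<close> turns exteriority into a lower
  bound on the denominator \<open>N\<close> of \<open>act A\<close>; the later estimates use this
  form.\<close>

lemma in_ford_region_iff:
  "(z, t) \<in> ford_region \<Gamma> \<longleftrightarrow>
     t > 0 \<and> (\<forall>A\<in>\<Gamma>. A$2$1 \<noteq> 0 \<longrightarrow> 1 \<le> (norm (A$2$1 * z + A$2$2))\<^sup>2 + (norm (A$2$1))\<^sup>2 * t\<^sup>2)"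
proof -
  have *: "(\<forall>m r. r > 0 \<and> hemisphere m r \<in> isometric_sphere ` (\<Gamma> - stab_infinity \<Gamma>) \<longrightarrow>
        r\<^sup>2 \<le> (norm (z - m))\<^sup>2 + t\<^sup>2) \<longleftrightarrow>
      (\<forall>A\<in>\<Gamma>. A$2$1 \<noteq> 0 \<longrightarrow> (1 / norm (A$2$1))\<^sup>2 \<le> (norm (z - (- (A$2$2) / A$2$1)))\<^sup>2 + t\<^sup>2)"
    (is "?L \<longleftrightarrow> ?R")
  proof
    show ?R if ?L
    proof (intro ballI impI)
      fix A assume A: "A \<in> \<Gamma>" "A$2$1 \<noteq> 0"
      then have "hemisphere (- (A$2$2) / A$2$1) (1 / norm (A$2$1))
          \<in> isometric_sphere ` (\<Gamma> - stab_infinity \<Gamma>)"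
        by (auto simp: isometric_sphere_def stab_infinity_def)
      moreover have "1 / norm (A$2$1) > 0" using A by simp
      ultimately show "(1 / norm (A$2$1))\<^sup>2 \<le> (norm (z - (- (A$2$2) / A$2$1)))\<^sup>2 + t\<^sup>2"
        using that by blast
    qed
    show ?L if ?R
    proof (intro allI impI, elim conjE imageE)
      fix m r A
      assume A: "r > 0" "hemisphere m r = isometric_sphere A" "A \<in> \<Gamma> - stab_infinity \<Gamma>"
      then have "A \<in> \<Gamma>" "A$2$1 \<noteq> 0" by (auto simp: stab_infinity_def)
      moreover from this have "m = - (A$2$2) / A$2$1 \<and> r = 1 / norm (A$2$1)"
        using A by (intro hemisphere_inj) (auto simp: isometric_sphere_def)
      ultimately show "r\<^sup>2 \<le> (norm (z - m))\<^sup>2 + t\<^sup>2" using that by blast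
    qed
  qed
  show ?thesis
    unfolding ford_region_def in_exterior_iff * by (intro conj_cong refl ball_cong imp_cong isometric_sphere_le_iff)
qed

lemma matrix_2x2_eqI:
  "A$1$1 = B$1$1 \<Longrightarrow> A$1$2 = B$1$2 \<Longrightarrow> A$2$1 = B$2$1 \<Longrightarrow> A$2$2 = B$2$2 \<Longrightarrow> A = B"
  for A B :: "'a^2^2"
  by (simp add: vec_eq_iff forall_2)

text \<open>Lower unipotent matrices multiply by adding their entries. As \<open>matrix_inv\<close>
  is defined by choice, uniqueness of the inverse is shown as well.\<close>

lemma matrix_inv_lower_unipotent: "matrix_inv (lower_unipotent c) = lower_unipotent (- c)"
proof -
  have mult: "lower_unipotent d ** lower_unipotent e = lower_unipotent (d + e)" for d e
    by (rule matrix_2x2_eqI) (simp_all add: lower_unipotent_def matrix_matrix_mult_def sum_2)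
  have one: "lower_unipotent 0 = mat 1"
    by (rule matrix_2x2_eqI) (simp_all add: lower_unipotent_def mat_def)
  show ?thesis
    unfolding matrix_inv_def
  proof (rule someI2)
    show "lower_unipotent c ** lower_unipotent (- c) = mat 1 \<and> lower_unipotent (- c) ** lower_unipotent c = mat 1"
      by (simp add: mult one)
    fix B assume "lower_unipotent c ** B = mat 1 \<and> B ** lower_unipotent c = mat 1"
    then have "lower_unipotent (- c) ** (lower_unipotent c ** B) = lower_unipotent (- c)" by simp
    then show "B = lower_unipotent (- c)" by (simp add: matrix_mul_assoc mult one)
  qed
qed

lemma isometric_sphere_lower_unipotent:
  "isometric_sphere (lower_unipotent c) = hemisphere (- 1 / c) (1 / norm c)"
  by (simp add: isometric_sphere_def lower_unipotent_def)

lemma translate_hemisphere: "(\<lambda>(z, t). (z + u, t)) ` hemisphere m r = hemisphere (m + u) r"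
proof -
  have 1: "(z + u, t) \<in> hemisphere (m + u) r" if "(z, t) \<in> hemisphere m r" for z t u m
    using that by (simp add: hemisphere_def H3_def dist_boundary dist_commute[of "(_, 0)"] algebra_simps)
  show ?thesis
  proof (rule equalityI; rule subsetI)
    fix x assume "x \<in> hemisphere (m + u) r"
    moreover obtain z t where "x = (z, t)" by fastforce
    ultimately have "(z - u, t) \<in> hemisphere m r" "x = (\<lambda>(z, t). (z + u, t)) (z - u, t)"
      using 1[of z t "m + u" "- u"] by simp_all
    then show "x \<in> (\<lambda>(z, t). (z + u, t)) ` hemisphere m r" by blast
  qed (auto intro: 1)
qed

definition translation :: "complex \<Rightarrow> complex^2^2" where
  "translation u = vector [vector [1, u], vector [0, 1]]"

lemma act_translation: "act (translation u) = (\<lambda>(z, t). (z + u, t))"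
  by (auto simp: act_def translation_def Let_def)

lemma translation_in_stab: "u \<in> carrier O11 \<Longrightarrow> translation u \<in> stab_infinity (Gamma0 g)"
  using of_int_O11[of 0] of_int_O11[of 1]
  by (auto simp: stab_infinity_def Gamma0_def translation_def det_2 forall_2 PIdl_O11_iff
      intro!: bexI[of _ 0])

text \<open>With lower left entry 0 the diagonal entries are mutually inverse units, hence both
  \<open>1\<close> or both \<open>- 1\<close>.\<close>

lemma stab_infinity_actE:
  assumes "A \<in> stab_infinity (Gamma0 g)"
  obtains u where "u \<in> carrier O11" "act A = (\<lambda>(z, t). (z + u, t))"
proof -
  have A: "A$1$1 * A$2$2 = 1" "A$2$1 = 0" "\<And>i j. A$i$j \<in> carrier O11"
    using assms by (auto simp: stab_infinity_def Gamma0_def det_2)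
  then have "A$1$1 = 1 \<and> A$2$2 = 1 \<or> A$1$1 = - 1 \<and> A$2$2 = - 1"
    using O11_unit_cases[of "A$1$1" "A$2$2"] by (auto simp: minus_equation_iff[of "A$2$2"])
  then show ?thesis
  proof
    assume "A$1$1 = 1 \<and> A$2$2 = 1"
    then show ?thesis using that[of "A$1$2"] A by (auto simp: act_def Let_def)
  next
    assume "A$1$1 = - 1 \<and> A$2$2 = - 1"
    then show ?thesis using that[of "- (A$1$2)"] A by (auto simp: act_def Let_def fun_eq_iff)
  qed
qed

section \<open>Prime level\<close>

locale level =
  fixes p :: nat and a b :: int and \<pi> :: complex
  assumes prime_p: "prime p" and pi_eq: "\<pi> = of_int a + of_int b * omega"
    and p_eq: "of_nat p = \<pi> * cnj \<pi>"
begin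

lemma pi_O11 [simp]: "\<pi> \<in> carrier O11"
  by (rule O11I[OF pi_eq])

lemma p_pos: "real p > 0"
  using prime_gt_0_nat[OF prime_p] by simp

lemma norm_sq_pi: "(norm \<pi>)\<^sup>2 = real p"
  using p_eq by (metis complex_norm_square of_real_eq_iff of_real_of_nat_eq)

lemma pi_nonzero [simp]: "\<pi> \<noteq> 0"
  using norm_sq_pi p_pos by auto

lemma norm_pi: "norm \<pi> = sqrt (real p)"
  using norm_sq_pi by (metis norm_ge_zero real_sqrt_unique)

section \<open>Residues modulo \<pi>\<close>

lemma p_dvd_of_int:
  assumes "of_int n = u * \<pi>" "u \<in> carrier O11"
  shows "int p dvd n"
proof -
  obtain k where k: "(norm u)\<^sup>2 = of_int k"
    using norm_sq_O11_Ints[OF assms(2)] by (elim Ints_cases)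
  have "(norm (of_int n :: complex))\<^sup>2 = of_int k * real p"
    unfolding assms(1) norm_mult power_mult_distrib norm_sq_pi k ..
  then have "real_of_int (n\<^sup>2) = real_of_int (k * int p)" by simp
  then have "n\<^sup>2 = k * int p" by (simp only: of_int_eq_iff)
  then have "int p dvd n\<^sup>2" by simp
  then show ?thesis using prime_p by (simp add: prime_dvd_power_iff)
qed

lemma of_int_mult_p_in_ideal:
  assumes "int p dvd n"
  obtains u where "u \<in> carrier O11" "of_int n = u * \<pi>"
proof -
  obtain k where "n = int p * k" using assms by (elim dvdE)
  then have "of_int n = (of_int k * cnj \<pi>) * \<pi>" using p_eq by (simp add: mult.commute)
  then show ?thesis by (intro that[of "of_int k * cnj \<pi>"]) auto
qed

text \<open>If \<open>p\<close> divided \<open>b\<close>, the norm equation would make it divide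
  \<open>a\<close> too, and then \<open>p\<^sup>2\<close> would divide \<open>p\<close>. So
  \<open>b\<close> is invertible modulo \<open>p\<close>.\<close>

lemma not_p_dvd_b: "\<not> int p dvd b"
proof
  assume b: "int p dvd b"
  have "real p = of_int (a\<^sup>2 - a * b + 3 * b\<^sup>2)"
    using norm_sq_pi unfolding pi_eq norm_sq_O11 by simp
  then have eq: "int p = a\<^sup>2 - a * b + 3 * b\<^sup>2" by linarith
  then have "a\<^sup>2 = int p + b * (a - 3 * b)" by (simp add: power2_eq_square algebra_simps)
  then have "int p dvd a\<^sup>2" using b by (metis dvd_add dvd_mult2 dvd_refl)
  then have "int p dvd a" using prime_p by (simp add: prime_dvd_power_iff)
  then obtain c d where cd: "a = int p * c" "b = int p * d" using b by (auto elim!: dvdE)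
  have "a\<^sup>2 - a * b + 3 * b\<^sup>2 = int p * (int p * (c\<^sup>2 - c * d + 3 * d\<^sup>2))"
    unfolding cd by (simp add: power2_eq_square algebra_simps)
  with eq have "int p * 1 = int p * (int p * (c\<^sup>2 - c * d + 3 * d\<^sup>2))" by linarith
  then have "1 = int p * (c\<^sup>2 - c * d + 3 * d\<^sup>2)"
    using p_pos by (simp only: mult_cancel_left) simp
  then have "int p dvd 1" by (rule dvdI)
  then show False using prime_gt_1_nat[OF prime_p] by simp
qed

text \<open>Multiplying \<open>a + b * omega = \<pi>\<close> by an inverse \<open>s\<close> of
  \<open>b\<close> modulo \<open>p\<close> gives \<open>omega\<close> congruent to
  \<open>- s * a\<close> modulo \<open>\<pi>\<close>, since \<open>p\<close> itself is a multiple of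
  \<open>\<pi>\<close>.\<close>

lemma exists_integer_residue:
  assumes "u \<in> carrier O11"
  obtains k v where "v \<in> carrier O11" "u = of_int k + v * \<pi>"
proof -
  obtain m n where u: "u = of_int m + of_int n * omega" using assms by (rule O11_cases)
  have "coprime b (int p)"
    using prime_imp_coprime[of "int p" b] prime_p not_p_dvd_b by (simp add: coprime_commute)
  then obtain s r where "s * b + r * int p = 1"
    using bezout_int[of b "int p"] by auto
  then have "1 - b * s = r * int p" by (simp add: algebra_simps)
  then have "int p dvd n * (1 - b * s)" by simp
  then obtain v where v: "v \<in> carrier O11" "of_int (n * (1 - b * s)) = v * \<pi>"
    by (rule of_int_mult_p_in_ideal)
  have "u = of_int (m - n * s * a) + (of_int (n * s) + v * omega) * \<pi>"
  proof -
    have "(of_int (n * s) + v * omega) * \<pi> = of_int (n * s) * \<pi> + (v * \<pi>) * omega"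
      by (simp add: algebra_simps)
    then show ?thesis unfolding v(2)[symmetric] by (simp add: u pi_eq algebra_simps)
  qed
  then show ?thesis by (rule that[rotated]) (use v in auto)
qed

abbreviation residues :: "int set" where
  "residues \<equiv> {- ((int p - 1) div 2)..(int p - 1) div 2}"

lemma exists_residue:
  assumes "odd p" "u \<in> carrier O11"
  obtains j v where "j \<in> residues" "v \<in> carrier O11" "u = of_int j + v * \<pi>"
proof -
  obtain k v where kv: "v \<in> carrier O11" "u = of_int k + v * \<pi>"
    using assms(2) by (rule exists_integer_residue)
  define h where "h = (int p - 1) div 2"
  have p: "int p = 2 * h + 1" using assms(1) by (auto simp: h_def elim!: oddE)
  \<comment> \<open>Adding \<open>h\<close> before the reduction and subtracting it afterwards
    centers the representative.\<close>
  define j where "j = (k + h) mod int p - h"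
  have "0 \<le> (k + h) mod int p" "(k + h) mod int p < int p" using p_pos by simp_all
  then have "j \<in> residues" unfolding j_def h_def[symmetric] using p by auto
  have "k - j = k + h - (k + h) mod int p" by (simp add: j_def)
  then have "int p dvd k - j" by (simp only: dvd_minus_mod)
  then obtain w where w: "w \<in> carrier O11" "of_int (k - j) = w * \<pi>"
    by (rule of_int_mult_p_in_ideal)
  then have "u = of_int j + (v + w) * \<pi>" using kv(2) by (simp add: algebra_simps)
  then show ?thesis using that[OF \<open>j \<in> residues\<close>, of "v + w"] kv(1) w(1) by simp
qed

lemma residues_inject:
  assumes "j \<in> residues" "k \<in> residues" "v \<in> carrier O11" "of_int j = of_int k + v * \<pi>"
  shows "j = k"
proof -
  have "int p dvd j - k" using assms by (intro p_dvd_of_int[of _ v]) auto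
  moreover have "\<bar>j - k\<bar> < int p" using assms(1,2) p_pos by auto
  ultimately show ?thesis using zdvd_not_zless[of "\<bar>j - k\<bar>"] by auto
qed

text \<open>The integer residue of \<open>u\<close> is prime to \<open>p\<close>, so the rational
  Bezout identity lifts. The result completes a prescribed bottom row to determinant 1.\<close>

lemma exists_bezout:
  assumes "u \<in> carrier O11" "u \<notin> PIdl\<^bsub>O11\<^esub> \<pi>"
  obtains x y where "x \<in> carrier O11" "y \<in> carrier O11" "x * u - y * \<pi> = 1"
proof -
  obtain k v where kv: "v \<in> carrier O11" "u = of_int k + v * \<pi>"
    using assms(1) by (rule exists_integer_residue)
  have "\<not> int p dvd k"
  proof
    assume "int p dvd k"
    then obtain w where "w \<in> carrier O11" "of_int k = w * \<pi>" by (rule of_int_mult_p_in_ideal)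
    then have "u = (w + v) * \<pi>" "w + v \<in> carrier O11" using kv by (auto simp: algebra_simps)
    then show False using assms(2) PIdl_O11_iff by blast
  qed
  then have "coprime k (int p)"
    using prime_imp_coprime[of "int p" k] prime_p by (simp add: coprime_commute)
  then obtain s r where "s * k + r * int p = 1"
    using bezout_int[of k "int p"] by auto
  then have "k * s - 1 = - r * int p" by (simp add: algebra_simps)
  then have "int p dvd k * s - 1" by simp
  then obtain w where w: "w \<in> carrier O11" "of_int (k * s - 1) = w * \<pi>"
    by (rule of_int_mult_p_in_ideal)
  have "of_int s * u - (w + of_int s * v) * \<pi> = 1"
    using w(2) by (simp add: kv(2) algebra_simps)
  then show ?thesis using that[of "of_int s" "w + of_int s * v"] w kv by simp
qed

lemma bottom_row_Gamma0:
  assumes "x \<in> carrier O11" "y \<in> carrier O11" "g \<in> carrier O11" "d \<in> carrier O11"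
    and "x * d - y * (g * \<pi>) = 1" "g \<noteq> 0"
  shows "hemisphere (- d / (g * \<pi>)) (1 / norm (g * \<pi>))
    \<in> isometric_sphere ` (Gamma0 \<pi> - stab_infinity (Gamma0 \<pi>))"
proof -
  let ?A = "vector [vector [x, y], vector [g * \<pi>, d]] :: complex^2^2"
  have "?A \<in> Gamma0 \<pi> - stab_infinity (Gamma0 \<pi>)"
    using assms by (auto simp: Gamma0_def stab_infinity_def det_2 forall_2 PIdl_O11_iff)
  moreover have "isometric_sphere ?A = hemisphere (- d / (g * \<pi>)) (1 / norm (g * \<pi>))"
    by (simp add: isometric_sphere_def)
  ultimately show ?thesis by (metis imageI)
qed

end

lemma exterior_antimono: "\<Sigma> \<subseteq> \<Sigma>' \<Longrightarrow> exterior \<Sigma>' \<subseteq> exterior \<Sigma>"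
  by (auto simp: exterior_def)

section \<open>Edges of the hexagon and Euclidean hulls over it\<close>

lemma open_hexagon_boundary:
  assumes "w \<in> hexagon" "w \<notin> open_hexagon"
  obtains n r where "n \<in> {1, Complex 1 (sqrt 11), Complex (- 1) (sqrt 11)}"
    "r \<in> {1 / 2, - 1 / 2, 3, - 3}" "n \<bullet> w = r"
proof -
  have "\<exists>n\<in>{1, Complex 1 (sqrt 11), Complex (- 1) (sqrt 11)}. \<exists>r\<in>{1 / 2, - 1 / 2, 3, - 3}. n \<bullet> w = r"
    using assms by (auto simp: hexagon_def open_hexagon_def inner_complex_def abs_if split: if_splits)
  then show ?thesis by (elim bexE) (rule that)
qed

lemma convex3D:
  assumes "convex S" "x \<in> S" "y \<in> S" "z \<in> S" "0 \<le> c" "0 \<le> d" "0 \<le> e" "c + d + e = 1"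
  shows "c *\<^sub>R x + d *\<^sub>R y + e *\<^sub>R z \<in> S"
proof -
  have "convex hull {x, y, z} \<subseteq> S" using assms by (intro hull_minimal) auto
  then show ?thesis using assms(5-8) unfolding convex_hull_3 by blast
qed

text \<open>The lifted corners all have Klein height \<open>9/11 + 2/11 = 1\<close>, so the floor of
  the cell is flat; two corners and the center \<open>(0, 1)\<close>, a midpoint of opposite
  corners, reach every \<open>w\<close>.\<close>

lemma convex_hull_hexagon:
  assumes "convex S" and S: "\<And>v. v \<in> corners \<Longrightarrow> (v, 1) \<in> S" and "w \<in> hexagon"
  shows "(w, 1 :: real) \<in> S"
proof -
  have "z1 \<in> corners" "- z1 \<in> corners" by (auto simp: corners_def)
  then have "(1 / 2) *\<^sub>R (z1, 1) + (1 / 2) *\<^sub>R (- z1, 1) \<in> S"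
    using S by (intro convexD[OF assms(1)]) auto
  then have 0: "(0, 1) \<in> S" by simp
  obtain v v' c d where vc: "v \<in> corners" "v' \<in> corners" "0 \<le> c" "0 \<le> d" "c + d \<le> 1"
    "w = c *\<^sub>R v + d *\<^sub>R v'"
    using assms(3) by (rule hexagon_triangulation)
  have "c *\<^sub>R (v, 1) + d *\<^sub>R (v', 1) + (1 - c - d) *\<^sub>R (0, 1) \<in> S"
    using vc S 0 by (intro convex3D[OF assms(1)]) auto
  then show ?thesis using vc(6) by simp
qed

text \<open>Here the center sits at height 0, so the combination over a triangle has height
  \<open>c + d\<close>. The three bounds on \<open>h\<close> will come from hemispheres through the
  cusp \<open>0\<close>.\<close>

lemma convex_hull_cusp_hexagon:
  assumes "convex S" and S: "\<And>v. v \<in> corners \<Longrightarrow> (v, 1) \<in> S" and "(0, 0) \<in> S" and "w \<in> hexagon"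
    and "2 * \<bar>Re w\<bar> \<le> h" "\<bar>Re w + sqrt 11 * Im w\<bar> / 3 \<le> h" "\<bar>sqrt 11 * Im w - Re w\<bar> / 3 \<le> h"
  shows "\<exists>k \<le> h. (w, k :: real) \<in> S"
proof -
  obtain v v' c d where vc: "v \<in> corners" "v' \<in> corners" "0 \<le> c" "0 \<le> d" "c + d \<le> 1"
    "w = c *\<^sub>R v + d *\<^sub>R v'"
    "c + d \<le> max (2 * \<bar>Re w\<bar>) (max (\<bar>Re w + sqrt 11 * Im w\<bar> / 3) (\<bar>sqrt 11 * Im w - Re w\<bar> / 3))"
    using assms(4) by (rule hexagon_triangulation)
  have "c *\<^sub>R (v, 1) + d *\<^sub>R (v', 1) + (1 - c - d) *\<^sub>R (0, 0) \<in> S"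
    using vc S assms(3) by (intro convex3D[OF assms(1)]) auto
  moreover have "c + d \<le> h" using vc(7) assms(5-7) by linarith
  ultimately show ?thesis using vc(6) by (intro exI[of _ "c + d"]) simp
qed

text \<open>Expanding the denominator condition of an isometric sphere leaves a form that is affine
  in Klein coordinates and nondecreasing in the Klein height.\<close>

lemma norm_sq_affine:
  "(norm (g * w + d))\<^sup>2 + (norm g)\<^sup>2 * s =
     (2 * cnj g * d, (norm g)\<^sup>2) \<bullet> (w, (norm w)\<^sup>2 + s) + (norm d)\<^sup>2"
  by (simp add: norm_sq_add norm_mult power_mult_distrib inner_complex_def algebra_simps)

context level
begin

section \<open>The sphere collection in the coordinate \<pi> z\<close>

abbreviation mus :: "complex set" where
  "mus \<equiv> {omega, - omega, omega + 1, - (omega + 1)}"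

lemma sphere_collection_eq:
  "sphere_collection p \<pi> =
     {hemisphere (\<alpha> / \<pi> + u) (1 / sqrt (real p)) | \<alpha> u.
        \<alpha> \<in> carrier O11 - PIdl\<^bsub>O11\<^esub> \<pi> \<and> u \<in> carrier O11} \<union>
     {hemisphere (1 / (\<mu> * \<pi>) + u) (1 / norm (\<mu> * \<pi>)) | \<mu> u. \<mu> \<in> mus \<and> u \<in> carrier O11}"
proof -
  define base where "base = {hemisphere (\<alpha> / \<pi>) (1 / sqrt (real p)) | \<alpha>.
      \<alpha> \<in> carrier O11 - PIdl\<^bsub>O11\<^esub> \<pi>} \<union> {hemisphere (1 / (\<mu> * \<pi>)) (1 / norm (\<mu> * \<pi>)) | \<mu>. \<mu> \<in> mus}"
  have iso: "isometric_sphere ` (M \<union> matrix_inv ` M) = {hemisphere (1 / (\<mu> * \<pi>)) (1 / norm (\<mu> * \<pi>)) | \<mu>. \<mu> \<in> mus}"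
    if "M = {lower_unipotent (omega * \<pi>), lower_unipotent ((omega + 1) * \<pi>)}" for M
  proof -
    \<comment> \<open>The isometric sphere of \<open>lower_unipotent c\<close> is centered at
      \<open>- 1 / c\<close>, so the sign puts the center at \<open>1 / (\<mu> * \<pi>)\<close>;
      \<open>mus\<close> is closed under negation.\<close>
    have "M \<union> matrix_inv ` M = (\<lambda>\<mu>. lower_unipotent (- \<mu> * \<pi>)) ` mus"
      by (simp only: that image_insert image_empty image_Un matrix_inv_lower_unipotent
          minus_mult_left minus_minus Un_insert_left Un_empty_left) blast
    then have "isometric_sphere ` (M \<union> matrix_inv ` M) =
        (\<lambda>\<mu>. isometric_sphere (lower_unipotent (- \<mu> * \<pi>))) ` mus" by (simp only: image_image)
    also have "\<dots> = (\<lambda>\<mu>. hemisphere (1 / (\<mu> * \<pi>)) (1 / norm (\<mu> * \<pi>))) ` mus"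
      by (rule image_cong) (simp_all add: isometric_sphere_lower_unipotent norm_mult)
    finally show ?thesis by blast
  qed
  have "sphere_collection p \<pi> = {act A ` S | A S. A \<in> stab_infinity (Gamma0 \<pi>) \<and> S \<in> base}"
    unfolding sphere_collection_def Let_def iso[OF refl] base_def ..
  also have "\<dots> = {(\<lambda>(z, t). (z + u, t)) ` S | u S. u \<in> carrier O11 \<and> S \<in> base}"
  proof (intro equalityI subsetI; elim CollectE exE conjE)
    fix S A S' assume "S = act A ` S'" "A \<in> stab_infinity (Gamma0 \<pi>)" "S' \<in> base"
    then show "S \<in> {(\<lambda>(z, t). (z + u, t)) ` S | u S. u \<in> carrier O11 \<and> S \<in> base}"
      by (elim stab_infinity_actE) auto
  next
    fix S u S' assume "S = (\<lambda>(z, t). (z + u, t)) ` S'" "u \<in> carrier O11" "S' \<in> base"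
    then have "S = act (translation u) ` S' \<and> translation u \<in> stab_infinity (Gamma0 \<pi>) \<and> S' \<in> base"
      by (simp add: act_translation translation_in_stab)
    then show "S \<in> {act A ` S | A S. A \<in> stab_infinity (Gamma0 \<pi>) \<and> S \<in> base}" by blast
  qed
  also have "\<dots> = {hemisphere (\<alpha> / \<pi> + u) (1 / sqrt (real p)) | \<alpha> u.
        \<alpha> \<in> carrier O11 - PIdl\<^bsub>O11\<^esub> \<pi> \<and> u \<in> carrier O11} \<union>
     {hemisphere (1 / (\<mu> * \<pi>) + u) (1 / norm (\<mu> * \<pi>)) | \<mu> u. \<mu> \<in> mus \<and> u \<in> carrier O11}"
    (is "?L = ?R")
  proof
    show "?L \<subseteq> ?R"
      unfolding base_def by (auto simp only: translate_hemisphere) blast+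
    show "?R \<subseteq> ?L"
      unfolding base_def by (auto simp only: translate_hemisphere[symmetric])
  qed
  finally show ?thesis .
qed


lemma norm_sq_mus: "\<mu> \<in> mus \<Longrightarrow> (norm \<mu>)\<^sup>2 = 3"
  unfolding cmod_power2 by (elim insertE emptyE) (simp_all, simp_all add: power2_eq_square)

text \<open>Scaling by \<open>\<pi>\<close> multiplies squared lengths by \<open>p\<close>, so the
  spheres acquire the radii \<open>1\<close> and \<open>1 / sqrt 3\<close>, independent of the
  level.\<close>

lemma exterior_sphere_collectionD:
  assumes "(z, t) \<in> exterior (sphere_collection p \<pi>)"
  shows "t > 0"
    and "u \<in> carrier O11 \<Longrightarrow> u \<notin> PIdl\<^bsub>O11\<^esub> \<pi> \<Longrightarrow> 1 \<le> (norm (\<pi> * z - u))\<^sup>2 + real p * t\<^sup>2"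
    and "v \<in> carrier O11 \<Longrightarrow> \<mu> \<in> mus \<Longrightarrow> 1 / 3 \<le> (norm (\<pi> * z - v * \<pi> - 1 / \<mu>))\<^sup>2 + real p * t\<^sup>2"
proof -
  note ext = assms[unfolded in_exterior_iff]
  show "t > 0" by (rule conjunct1[OF ext])
  have scale: "(norm (\<pi> * z - w))\<^sup>2 = real p * (norm (z - m))\<^sup>2" if "w = \<pi> * m" for w m
    unfolding that right_diff_distrib[symmetric] norm_mult power_mult_distrib norm_sq_pi ..
  show "1 \<le> (norm (\<pi> * z - u))\<^sup>2 + real p * t\<^sup>2" if "u \<in> carrier O11" "u \<notin> PIdl\<^bsub>O11\<^esub> \<pi>"
  proof -
    have "hemisphere (u / \<pi> + of_int 0) (1 / sqrt p) \<in> sphere_collection p \<pi>"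
      unfolding sphere_collection_eq using that of_int_O11 by blast
    then have "(1 / sqrt p)\<^sup>2 \<le> (norm (z - u / \<pi>))\<^sup>2 + t\<^sup>2"
      using ext p_pos by simp
    then have "p * (1 / sqrt p)\<^sup>2 \<le> p * ((norm (z - u / \<pi>))\<^sup>2 + t\<^sup>2)"
      by (rule mult_left_mono) simp
    then show ?thesis
      using p_pos scale[of u "u / \<pi>"] by (simp add: power_divide distrib_left)
  qed
  show "1 / 3 \<le> (norm (\<pi> * z - v * \<pi> - 1 / \<mu>))\<^sup>2 + real p * t\<^sup>2" if "v \<in> carrier O11" "\<mu> \<in> mus"
  proof -
    have "hemisphere (1 / (\<mu> * \<pi>) + v) (1 / norm (\<mu> * \<pi>)) \<in> sphere_collection p \<pi>"
      unfolding sphere_collection_eq using that by blast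
    moreover have mu: "(norm \<mu>)\<^sup>2 = 3"
      using norm_sq_mus[OF that(2)] .
    then have "\<mu> \<noteq> 0" by auto
    then have "1 / norm (\<mu> * \<pi>) > 0" by simp
    ultimately have "(1 / norm (\<mu> * \<pi>))\<^sup>2 \<le> (norm (z - (1 / (\<mu> * \<pi>) + v)))\<^sup>2 + t\<^sup>2"
      using ext by blast
    then have "p * (1 / norm (\<mu> * \<pi>))\<^sup>2 \<le> p * ((norm (z - (1 / (\<mu> * \<pi>) + v)))\<^sup>2 + t\<^sup>2)"
      by (rule mult_left_mono) simp
    moreover have "\<pi> * z - v * \<pi> - 1 / \<mu> = \<pi> * z - (v * \<pi> + 1 / \<mu>)" by simp
    ultimately show ?thesis
      using p_pos scale[of "v * \<pi> + 1 / \<mu>" "1 / (\<mu> * \<pi>) + v"] mu \<open>\<mu> \<noteq> 0\<close>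
      by (simp add: power_divide distrib_left norm_mult power_mult_distrib norm_sq_pi field_simps)
  qed
qed

lemma ford_region_subset_exterior:
  "ford_region (Gamma0 \<pi>) \<subseteq> exterior (sphere_collection p \<pi>)"
  unfolding ford_region_def
proof (rule exterior_antimono, rule subsetI)
  fix S assume "S \<in> sphere_collection p \<pi>"
  then consider \<alpha> u where "S = hemisphere (\<alpha> / \<pi> + u) (1 / sqrt p)" "\<alpha> \<in> carrier O11"
      "\<alpha> \<notin> PIdl\<^bsub>O11\<^esub> \<pi>" "u \<in> carrier O11"
    | \<mu> u where "S = hemisphere (1 / (\<mu> * \<pi>) + u) (1 / norm (\<mu> * \<pi>))" "\<mu> \<in> mus" "u \<in> carrier O11"
    unfolding sphere_collection_eq by blast
  then show "S \<in> isometric_sphere ` (Gamma0 \<pi> - stab_infinity (Gamma0 \<pi>))"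
  proof cases
    case 1
    obtain x y where xy: "x \<in> carrier O11" "y \<in> carrier O11" "x * \<alpha> - y * \<pi> = 1"
      using 1(2,3) by (rule exists_bezout)
    have "hemisphere (- (- (\<alpha> + u * \<pi>)) / (1 * \<pi>)) (1 / norm (1 * \<pi>))
        \<in> isometric_sphere ` (Gamma0 \<pi> - stab_infinity (Gamma0 \<pi>))"
    proof (rule bottom_row_Gamma0)
      \<comment> \<open>The top row \<open>- x\<close>, \<open>y + x * u\<close> is the Bezout
        solution transported by the translation \<open>u\<close>.\<close>
      show "(- x) * (- (\<alpha> + u * \<pi>)) - (y + x * u) * (1 * \<pi>) = 1"
        using xy(3) by (simp add: algebra_simps)
    qed (use xy 1 of_int_O11[of 1] in auto)
    moreover have "- (- (\<alpha> + u * \<pi>)) / (1 * \<pi>) = \<alpha> / \<pi> + u" by (simp add: add_divide_distrib)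
    ultimately show ?thesis using 1(1) by (simp add: norm_pi)
  next
    case 2
    have mu: "\<mu> \<in> carrier O11" "\<mu> \<noteq> 0"
      using 2(2) of_int_O11[of 1] norm_sq_mus[OF 2(2)] by auto
    have "hemisphere (- (- (1 + u * (\<mu> * \<pi>))) / (\<mu> * \<pi>)) (1 / norm (\<mu> * \<pi>))
        \<in> isometric_sphere ` (Gamma0 \<pi> - stab_infinity (Gamma0 \<pi>))"
    proof (rule bottom_row_Gamma0)
      \<comment> \<open>Up to sign this is the lower unipotent matrix with entry
        \<open>- \<mu> * \<pi>\<close> times the translation by \<open>- u\<close>.\<close>
      show "(- 1) * (- (1 + u * (\<mu> * \<pi>))) - u * (\<mu> * \<pi>) = 1" by simp
    qed (use mu 2 of_int_O11[of 1] of_int_O11[of "- 1"] in auto)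
    moreover have "- (- (1 + u * (\<mu> * \<pi>))) / (\<mu> * \<pi>) = 1 / (\<mu> * \<pi>) + u"
      using mu by (simp add: add_divide_distrib)
    ultimately show ?thesis using 2(1) by simp
  qed
qed

lemma ford_region_translate:
  assumes "(z, t) \<in> ford_region (Gamma0 \<pi>)" "v \<in> carrier O11"
  shows "(z + v, t) \<in> ford_region (Gamma0 \<pi>)"
  unfolding in_ford_region_iff
proof (intro conjI ballI impI)
  show "t > 0" using assms(1) by (simp add: in_ford_region_iff)
  fix A assume A: "A \<in> Gamma0 \<pi>" "A$2$1 \<noteq> 0"
  \<comment> \<open>\<open>?B\<close> is \<open>A\<close> times the translation by \<open>v\<close>,
    so its condition at \<open>z\<close> is the condition of \<open>A\<close> at
    \<open>z + v\<close>.\<close>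
  let ?B = "vector [vector [A$1$1, A$1$1 * v + A$1$2], vector [A$2$1, A$2$1 * v + A$2$2]] :: complex^2^2"
  have "?B \<in> Gamma0 \<pi>"
    using A(1) assms(2) by (auto simp: Gamma0_def det_2 forall_2 algebra_simps)
  then have "1 \<le> (norm (?B$2$1 * z + ?B$2$2))\<^sup>2 + (norm (?B$2$1))\<^sup>2 * t\<^sup>2"
    using assms(1) A(2) unfolding in_ford_region_iff by (metis vector_2)
  then show "1 \<le> (norm (A$2$1 * (z + v) + A$2$2))\<^sup>2 + (norm (A$2$1))\<^sup>2 * t\<^sup>2"
    by (simp add: algebra_simps)
qed

section \<open>The hulls in the coordinate \<pi> z\<close>

definition lift_hexagon :: "int \<Rightarrow> (complex \<times> real) set" where
  "lift_hexagon j = (\<lambda>v. (of_int j + v, sqrt (2 / 11))) ` corners"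

text \<open>Division by \<open>\<pi>\<close>, with heights divided by \<open>sqrt p\<close>, is a
  similarity of upper half-space; in Klein coordinates it is the linear map \<open>\<phi>\<close>,
  which commutes with convex hulls.\<close>

lemma in_scaled_hull_iff:
  assumes "\<And>w s. (w, s) \<in> Q \<Longrightarrow> s \<ge> 0"
  shows "(z, t) \<in> hyp_convex_hull (insert Infinity ((\<lambda>(w, s). Pt (w / \<pi>) (s / sqrt p)) ` Q)) \<longleftrightarrow>
    t > 0 \<and> (\<exists>h \<le> (norm (\<pi> * z))\<^sup>2 + real p * t\<^sup>2. (\<pi> * z, h) \<in> convex hull (klein ` Q))"
proof -
  define f where "f = (\<lambda>(w :: complex, s :: real). (w / \<pi>, s / sqrt p))"
  define \<phi> where "\<phi> = (\<lambda>(w :: complex, h :: real). (w / \<pi>, h / p))"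
  have "linear \<phi>"
    by (rule linearI) (auto simp: \<phi>_def add_divide_distrib scaleR_conv_of_real)
  have "klein (f x) = \<phi> (klein x)" for x
    using p_pos by (cases x) (simp add: f_def \<phi>_def norm_divide power_divide norm_sq_pi add_divide_distrib)
  then have "convex hull (klein ` f ` Q) = \<phi> ` (convex hull (klein ` Q))"
    using convex_hull_linear_image[OF \<open>linear \<phi>\<close>] by (simp add: image_image)
  moreover have "(z, h) \<in> \<phi> ` S \<longleftrightarrow> (\<pi> * z, real p * h) \<in> S" for h S
  proof
    assume "(\<pi> * z, real p * h) \<in> S"
    moreover have "(z, h) = \<phi> (\<pi> * z, real p * h)" using p_pos by (simp add: \<phi>_def)
    ultimately show "(z, h) \<in> \<phi> ` S" by blast
  qed (use p_pos in \<open>auto simp: \<phi>_def\<close>)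
  ultimately have hull: "(z, h) \<in> convex hull (klein ` f ` Q) \<longleftrightarrow> (\<pi> * z, real p * h) \<in> convex hull (klein ` Q)" for h
    by simp
  have "(\<lambda>(w, s). Pt (w / \<pi>) (s / sqrt p)) ` Q = (\<lambda>(z, t). Pt z t) ` f ` Q"
    by (auto simp: f_def image_image split_beta)
  moreover have "t \<ge> 0" if "(z, t) \<in> f ` Q" for z t
    using that assms by (auto simp: f_def)
  ultimately have "(z, t) \<in> hyp_convex_hull (insert Infinity ((\<lambda>(w, s). Pt (w / \<pi>) (s / sqrt p)) ` Q)) \<longleftrightarrow>
      t > 0 \<and> (\<exists>h \<le> (norm z)\<^sup>2 + t\<^sup>2. (\<pi> * z, real p * h) \<in> convex hull (klein ` Q))"
    using hyp_convex_hull_insert_Infinity[of "f ` Q"] by (simp add: H3_def hull)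
  also have "(\<exists>h \<le> (norm z)\<^sup>2 + t\<^sup>2. (\<pi> * z, real p * h) \<in> convex hull (klein ` Q)) \<longleftrightarrow>
      (\<exists>h \<le> (norm (\<pi> * z))\<^sup>2 + real p * t\<^sup>2. (\<pi> * z, h) \<in> convex hull (klein ` Q))" (is "?L \<longleftrightarrow> ?R")
  proof -
    have eq: "(norm (\<pi> * z))\<^sup>2 + real p * t\<^sup>2 = p * ((norm z)\<^sup>2 + t\<^sup>2)"
      by (simp add: norm_mult power_mult_distrib norm_sq_pi distrib_left)
    show ?thesis
      unfolding eq
    proof
      assume ?L then show "\<exists>h \<le> p * ((norm z)\<^sup>2 + t\<^sup>2). (\<pi> * z, h) \<in> convex hull (klein ` Q)"
        using p_pos by (metis mult_left_mono order_less_imp_le)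
    next
      assume "\<exists>h \<le> p * ((norm z)\<^sup>2 + t\<^sup>2). (\<pi> * z, h) \<in> convex hull (klein ` Q)"
      then obtain h where "h \<le> p * ((norm z)\<^sup>2 + t\<^sup>2)" "(\<pi> * z, h) \<in> convex hull (klein ` Q)" by blast
      then show ?L using p_pos by (intro exI[of _ "h / p"]) (simp add: field_simps)
    qed
  qed
  finally show ?thesis .
qed

lemma hexagon_vertices_eq:
  "hexagon_vertices p \<pi> j = (\<lambda>(w, s). Pt (w / \<pi>) (s / sqrt p)) ` lift_hexagon j"
  unfolding hexagon_vertices_def corners_def[symmetric] lift_hexagon_def Setcompr_eq_image image_image
  by (simp add: real_sqrt_divide real_sqrt_mult)

lemma in_hexagon_hull_iff:
  "(z, t) \<in> hyp_convex_hull ({Infinity} \<union> hexagon_vertices p \<pi> j) \<longleftrightarrow>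
    t > 0 \<and> (\<exists>h \<le> (norm (\<pi> * z))\<^sup>2 + real p * t\<^sup>2. (\<pi> * z, h) \<in> convex hull (klein ` lift_hexagon j))"
proof -
  have "s \<ge> 0" if "(w, s) \<in> lift_hexagon j" for w s
    using that by (auto simp: lift_hexagon_def)
  from in_scaled_hull_iff[of "lift_hexagon j", OF this] show ?thesis by (simp add: hexagon_vertices_eq)
qed

lemma in_cusp_hull_iff:
  "(z, t) \<in> hyp_convex_hull ({Pt 0 0, Infinity} \<union> hexagon_vertices p \<pi> 0) \<longleftrightarrow>
    t > 0 \<and> (\<exists>h \<le> (norm (\<pi> * z))\<^sup>2 + real p * t\<^sup>2.
      (\<pi> * z, h) \<in> convex hull (klein ` insert (0, 0) (lift_hexagon 0)))"
proof -
  have "s \<ge> 0" if "(w, s) \<in> insert (0, 0) (lift_hexagon 0)" for w s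
    using that by (auto simp: lift_hexagon_def)
  from in_scaled_hull_iff[of "insert (0, 0) (lift_hexagon 0)", OF this] show ?thesis
    by (simp add: hexagon_vertices_eq insert_commute[of Infinity])
qed

section \<open>The union of the hulls and the prism over the hexagons\<close>

definition domain_cells :: "(complex \<times> real) set" where
  "domain_cells = hyp_convex_hull ({Pt 0 0, Infinity} \<union> hexagon_vertices p \<pi> 0) \<union>
     (\<Union>j \<in> residues. hyp_convex_hull ({Infinity} \<union> hexagon_vertices p \<pi> j))"

text \<open>As \<open>residues\<close> represents the lattice modulo \<open>\<pi>\<close> for odd
  \<open>p\<close>, the hexagons about these \<open>j\<close> together tile the plane of
  \<open>\<pi> * z\<close> under translation by multiples of \<open>\<pi>\<close>.\<close>

definition prism :: "(complex \<times> real) set" where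
  "prism = {(z, t). t > 0 \<and> (\<exists>j\<in>residues. \<pi> * z - of_int j \<in> hexagon)}"

text \<open>For \<open>j \<noteq> 0\<close> the unit sphere about \<open>j\<close> bounds the Klein
  height by the flat floor of the cell. For \<open>j = 0\<close> that sphere is missing, since
  \<open>0\<close> lies in the ideal, and spheres through the cusp \<open>0\<close> bound the height
  by the cone with apex \<open>0\<close>.\<close>

lemma in_domain_cellsI:
  assumes "t > 0" "j \<in> residues" "\<pi> * z - of_int j \<in> hexagon"
    and unit: "\<And>u. u \<in> carrier O11 \<Longrightarrow> u \<notin> PIdl\<^bsub>O11\<^esub> \<pi> \<Longrightarrow> 1 \<le> (norm (\<pi> * z - u))\<^sup>2 + real p * t\<^sup>2"
    and small: "\<And>\<mu>. \<mu> \<in> mus \<Longrightarrow> 1 / 3 \<le> (norm (\<pi> * z - 1 / \<mu>))\<^sup>2 + real p * t\<^sup>2"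
  shows "(z, t) \<in> domain_cells"
proof (cases "j = 0")
  case False
  have "of_int j \<notin> PIdl\<^bsub>O11\<^esub> \<pi>"
  proof
    assume "of_int j \<in> PIdl\<^bsub>O11\<^esub> \<pi>"
    then have "int p dvd j" unfolding PIdl_O11_iff by (auto intro: p_dvd_of_int)
    moreover have "\<bar>j\<bar> < int p" using assms(2) p_pos by auto
    ultimately show False using False zdvd_not_zless[of "\<bar>j\<bar>" "int p"] by auto
  qed
  then have h: "1 \<le> (norm (\<pi> * z - of_int j))\<^sup>2 + real p * t\<^sup>2" by (intro unit) auto
  define w where "w = \<pi> * z - of_int j"
  \<comment> \<open>\<open>\<psi>\<close> is the translation by \<open>j\<close> in Klein
    coordinates; it is affine, so the hull can be compared with the one centered at
    \<open>0\<close>.\<close>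
  define \<psi> where "\<psi> = (\<lambda>(w, h). (of_int j + w :: complex, (real_of_int j)\<^sup>2 + 2 * real_of_int j * Re w + h))"
  have "convex (\<psi> -` (convex hull (klein ` lift_hexagon j)))"
  proof (rule convex_alt[THEN iffD2], intro ballI allI impI)
    fix x y :: "complex \<times> real" and u :: real
    assume xy: "x \<in> \<psi> -` (convex hull (klein ` lift_hexagon j))" "y \<in> \<psi> -` (convex hull (klein ` lift_hexagon j))"
      and u: "0 \<le> u \<and> u \<le> 1"
    have "\<psi> ((1 - u) *\<^sub>R x + u *\<^sub>R y) = (1 - u) *\<^sub>R \<psi> x + u *\<^sub>R \<psi> y"
      by (cases x; cases y) (simp add: \<psi>_def complex_eq_iff algebra_simps)
    moreover have "(1 - u) *\<^sub>R \<psi> x + u *\<^sub>R \<psi> y \<in> convex hull (klein ` lift_hexagon j)"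
      using xy u by (intro convexD_alt) auto
    ultimately show "(1 - u) *\<^sub>R x + u *\<^sub>R y \<in> \<psi> -` (convex hull (klein ` lift_hexagon j))" by simp
  qed
  moreover have "(v, 1) \<in> \<psi> -` (convex hull (klein ` lift_hexagon j))" if "v \<in> corners" for v
  proof -
    have "\<psi> (v, 1) = klein (of_int j + v, sqrt (2 / 11))"
      using norm_sq_corners[OF that] by (simp add: \<psi>_def norm_sq_add)
    moreover have "klein (of_int j + v, sqrt (2 / 11)) \<in> convex hull (klein ` lift_hexagon j)"
      using that by (intro hull_inc imageI) (auto simp: lift_hexagon_def)
    ultimately show ?thesis by (simp only: vimage_eq)
  qed
  ultimately have "(w, 1) \<in> \<psi> -` (convex hull (klein ` lift_hexagon j))"
    using assms(3) unfolding w_def by (rule convex_hull_hexagon)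
  then have "(\<pi> * z, (real_of_int j)\<^sup>2 + 2 * real_of_int j * Re w + 1) \<in> convex hull (klein ` lift_hexagon j)"
    by (simp add: \<psi>_def w_def)
  moreover have "(norm (\<pi> * z))\<^sup>2 = (real_of_int j)\<^sup>2 + 2 * real_of_int j * Re w + (norm w)\<^sup>2"
    using norm_sq_add[of "of_int j" w] by (simp add: w_def)
  then have "(real_of_int j)\<^sup>2 + 2 * real_of_int j * Re w + 1 \<le> (norm (\<pi> * z))\<^sup>2 + real p * t\<^sup>2"
    using h unfolding w_def by linarith
  ultimately have "(z, t) \<in> hyp_convex_hull ({Infinity} \<union> hexagon_vertices p \<pi> j)"
    using assms(1) unfolding in_hexagon_hull_iff by blast
  then show ?thesis using assms(2) unfolding domain_cells_def by blast
next
  case True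
  define w where "w = \<pi> * z"
  define h where "h = (norm w)\<^sup>2 + real p * t\<^sup>2"
  have norm_sq_diff: "(norm (w - y))\<^sup>2 = (norm w)\<^sup>2 - 2 * Re (w * cnj y) + (norm y)\<^sup>2" for y
    using norm_sq_add[of w "- y"] by simp
  have not_unit: "of_int n \<notin> PIdl\<^bsub>O11\<^esub> \<pi>" if "\<bar>n\<bar> = 1" for n
  proof
    assume "of_int n \<in> PIdl\<^bsub>O11\<^esub> \<pi>"
    then have "int p dvd n" unfolding PIdl_O11_iff by (auto intro: p_dvd_of_int)
    then have "int p dvd \<bar>n\<bar>" by simp
    then show False using prime_gt_1_nat[OF prime_p] unfolding that by simp
  qed
  \<comment> \<open>The spheres used from here on pass through \<open>0\<close>, so constant terms
    cancel: those about \<open>1\<close> and \<open>- 1\<close> bound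
    \<open>2 * \<bar>Re w\<bar>\<close>, those about \<open>1 / \<mu>\<close> bound the two oblique
    forms.\<close>
  have "2 * \<bar>Re w\<bar> \<le> h"
    using unit[OF of_int_O11 not_unit, of 1, folded w_def]
      unit[OF of_int_O11 not_unit, of "- 1", folded w_def]
    by (simp add: norm_sq_diff[of 1] norm_sq_diff[of "- 1", simplified] h_def abs_le_iff)
  moreover have mu: "2 * Re (w * \<mu>) / 3 \<le> h" if "\<mu> \<in> mus" for \<mu>
  proof -
    have n: "(norm \<mu>)\<^sup>2 = 3"
      using norm_sq_mus[OF that] .
    then have "cnj (1 / \<mu>) = \<mu> / 3"
      using complex_div_cnj[of 1 "cnj \<mu>"] by simp
    then have "Re (w * cnj (1 / \<mu>)) = Re (w * \<mu>) / 3"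
      by (simp only: times_divide_eq_right Re_divide_numeral)
    moreover have "(norm (1 / \<mu>))\<^sup>2 = 1 / 3" using n by (simp add: norm_divide power_divide)
    ultimately show ?thesis
      using small[OF that] norm_sq_diff[of "1 / \<mu>"] by (simp add: h_def w_def)
  qed
  have "\<bar>Re w + sqrt 11 * Im w\<bar> / 3 \<le> h" "\<bar>sqrt 11 * Im w - Re w\<bar> / 3 \<le> h"
    using mu[of omega] mu[of "- omega"] mu[of "omega + 1"] mu[of "- (omega + 1)"]
    by (simp_all add: algebra_simps abs_le_iff)
  moreover have "(v, 1) \<in> convex hull (klein ` insert (0, 0) (lift_hexagon 0))" if "v \<in> corners" for v
  proof -
    have "(v, 1) = klein (v, sqrt (2 / 11))"
      using norm_sq_corners[OF that] by simp
    moreover have "klein (v, sqrt (2 / 11)) \<in> convex hull (klein ` insert (0, 0) (lift_hexagon 0))"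
      using that by (intro hull_inc imageI) (auto simp: lift_hexagon_def)
    ultimately show ?thesis by (simp only:)
  qed
  moreover have "(0, 0) \<in> convex hull (klein ` insert (0, 0) (lift_hexagon 0))"
    by (rule hull_inc) simp
  moreover have "w \<in> hexagon" using assms(3) True by (simp add: w_def)
  ultimately have "\<exists>k \<le> h. (w, k) \<in> convex hull (klein ` insert (0, 0) (lift_hexagon 0))"
    by (intro convex_hull_cusp_hexagon) auto
  then show ?thesis
    using assms(1) unfolding domain_cells_def Un_iff in_cusp_hull_iff h_def w_def by blast
qed


text \<open>The form is affine, so it suffices to bound it at the vertices: by
  \<open>corner_form_ge_1\<close> at the corners, and by the norm of \<open>A$2$2\<close> at the
  cusp \<open>0\<close>.\<close>

lemma ford_form_ge_1:
  assumes A: "A \<in> Gamma0 \<pi>" "A$2$1 = g * \<pi>" and "g \<noteq> 0"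
    and x: "(w, h) \<in> convex hull (klein ` Q)"
    and Q: "Q = lift_hexagon j \<or> Q = insert (0, 0) (lift_hexagon 0)"
  shows "1 \<le> (2 * cnj g * (A$2$2), (norm g)\<^sup>2) \<bullet> (w, h) + (norm (A$2$2))\<^sup>2"
proof -
  let ?d = "A$2$2"
  let ?H = "{x. (2 * cnj g * ?d, (norm g)\<^sup>2) \<bullet> x \<ge> 1 - (norm ?d)\<^sup>2}"
  have O: "?d \<in> carrier O11" "A$1$1 \<in> carrier O11" "A$1$2 \<in> carrier O11"
    and det: "A$1$1 * ?d - A$1$2 * (g * \<pi>) = 1"
    using A by (auto simp: Gamma0_def det_2)
  have g: "g \<in> carrier O11"
    using A \<open>g \<noteq> 0\<close> by (auto simp: Gamma0_def PIdl_O11_iff)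
  have iff: "klein (w, s) \<in> ?H \<longleftrightarrow> 1 \<le> (norm (g * w + ?d))\<^sup>2 + (norm g)\<^sup>2 * s\<^sup>2" for w s
    unfolding norm_sq_affine by simp linarith
  \<comment> \<open>If the entry vanished, \<open>\<pi>\<close> would divide the determinant 1; so
    no such element maps the cusp \<open>0\<close> to \<open>\<infinity>\<close>.\<close>
  have "?d \<noteq> 0"
  proof
    assume "?d = 0"
    then have "of_int 1 = (- (A$1$2) * g) * \<pi>" using det by (simp add: mult.assoc)
    then have "int p dvd 1" by (rule p_dvd_of_int) (use O g in auto)
    then show False using prime_gt_1_nat[OF prime_p] by simp
  qed
  then have zero: "klein (0, 0) \<in> ?H" unfolding iff using norm_sq_O11_ge_1[OF O(1)] by simp
  have corner: "klein (of_int j + v, sqrt (2 / 11)) \<in> ?H" if "v \<in> corners" for v j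
  proof -
    have "1 \<le> (norm (g * v + (g * of_int j + ?d)))\<^sup>2 + (norm g)\<^sup>2 * (2 / 11)"
      using that g O \<open>g \<noteq> 0\<close> by (intro corner_form_ge_1) auto
    then show ?thesis unfolding iff by (simp add: algebra_simps)
  qed
  have "klein ` lift_hexagon j \<subseteq> ?H" for j
    unfolding lift_hexagon_def image_image by (intro image_subsetI corner)
  with Q zero have "klein ` Q \<subseteq> ?H"
    by (elim disjE) (simp_all only: image_insert insert_subset)
  moreover have "convex ?H" by (rule convex_halfspace_ge)
  ultimately have "(w, h) \<in> ?H" using x hull_minimal[of "klein ` Q" ?H convex] by blast
  then show ?thesis by simp
qed

lemma domain_cellsE:
  assumes "(z, t) \<in> domain_cells"
  obtains j Q h where "j \<in> residues" "Q = lift_hexagon j \<or> j = 0 \<and> Q = insert (0, 0) (lift_hexagon 0)"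
    "t > 0" "h \<le> (norm (\<pi> * z))\<^sup>2 + real p * t\<^sup>2" "(\<pi> * z, h) \<in> convex hull (klein ` Q)"
proof -
  have "0 \<in> residues" using p_pos by auto
  then show ?thesis
    using assms that unfolding domain_cells_def Un_iff UN_iff in_cusp_hull_iff in_hexagon_hull_iff by blast
qed

lemma domain_cells_subset_ford_region: "domain_cells \<subseteq> ford_region (Gamma0 \<pi>)"
proof (rule subsetI, clarify)
  fix z t assume "(z, t) \<in> domain_cells"
  then obtain j Q h where *: "Q = lift_hexagon j \<or> Q = insert (0, 0) (lift_hexagon 0)"
    "t > 0" "h \<le> (norm (\<pi> * z))\<^sup>2 + real p * t\<^sup>2" "(\<pi> * z, h) \<in> convex hull (klein ` Q)"
    by (elim domain_cellsE) blast
  show "(z, t) \<in> ford_region (Gamma0 \<pi>)"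
    unfolding in_ford_region_iff
  proof (intro conjI ballI impI)
    fix A assume A: "A \<in> Gamma0 \<pi>" "A$2$1 \<noteq> 0"
    then obtain g where g: "A$2$1 = g * \<pi>" by (auto simp: Gamma0_def PIdl_O11_iff)
    have "1 \<le> (2 * cnj g * (A$2$2), (norm g)\<^sup>2) \<bullet> (\<pi> * z, h) + (norm (A$2$2))\<^sup>2"
      using A g * by (intro ford_form_ge_1) auto
    \<comment> \<open>The coefficient \<open>(norm g)\<^sup>2\<close> of the height is nonnegative,
      so the bound survives moving up from the Euclidean hull.\<close>
    also have "\<dots> \<le> (2 * cnj g * (A$2$2), (norm g)\<^sup>2) \<bullet> (\<pi> * z, (norm (\<pi> * z))\<^sup>2 + real p * t\<^sup>2)
        + (norm (A$2$2))\<^sup>2"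
      using *(3) by (simp add: mult_left_mono)
    also have "\<dots> = (norm (g * (\<pi> * z) + A$2$2))\<^sup>2 + (norm g)\<^sup>2 * (real p * t\<^sup>2)"
      by (rule norm_sq_affine[symmetric])
    finally show "1 \<le> (norm (A$2$1 * z + A$2$2))\<^sup>2 + (norm (A$2$1))\<^sup>2 * t\<^sup>2"
      by (simp add: g norm_mult power_mult_distrib norm_sq_pi mult.assoc)
  qed (fact *)
qed

lemma domain_cells_subset_prism: "domain_cells \<subseteq> prism"
proof (rule subsetI, clarify)
  fix z t assume "(z, t) \<in> domain_cells"
  then obtain j Q h where *: "j \<in> residues"
    "Q = lift_hexagon j \<or> j = 0 \<and> Q = insert (0, 0) (lift_hexagon 0)"
    "t > 0" "(\<pi> * z, h) \<in> convex hull (klein ` Q)"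
    by (elim domain_cellsE) blast
  have "convex ((\<lambda>w. of_int j + w) ` hexagon \<times> (UNIV :: real set))"
    by (intro convex_Times convex_translation convex_hexagon) simp
  moreover have "klein ` Q \<subseteq> (\<lambda>w. of_int j + w) ` hexagon \<times> UNIV"
    using *(2) corners_subset_hexagon zero_in_hexagon by (auto simp: lift_hexagon_def)
  ultimately have "convex hull (klein ` Q) \<subseteq> (\<lambda>w. of_int j + w) ` hexagon \<times> UNIV"
    by (intro hull_minimal)
  then have "\<pi> * z - of_int j \<in> hexagon" using *(4) by force
  then show "(z, t) \<in> prism" using * by (auto simp: prism_def)
qed

lemma exterior_Int_prism_subset_domain_cells:
  "exterior (sphere_collection p \<pi>) \<inter> prism \<subseteq> domain_cells"
proof (rule subsetI, clarify)
  fix z t assume ext: "(z, t) \<in> exterior (sphere_collection p \<pi>)" and "(z, t) \<in> prism"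
  then obtain j where "t > 0" "j \<in> residues" "\<pi> * z - of_int j \<in> hexagon"
    by (auto simp: prism_def)
  then show "(z, t) \<in> domain_cells"
    using exterior_sphere_collectionD(2)[OF ext] exterior_sphere_collectionD(3)[OF ext, of 0] of_int_O11[of 0]
    by (intro in_domain_cellsI) auto
qed

lemma prism_cover:
  assumes "odd p" "t > 0"
  obtains v where "v \<in> carrier O11" "(z - v, t) \<in> prism"
proof -
  obtain u where u: "u \<in> carrier O11" "\<pi> * z - u \<in> hexagon" by (rule hexagon_cover)
  obtain j v where "j \<in> residues" "v \<in> carrier O11" "u = of_int j + v * \<pi>"
    using assms(1) u(1) by (rule exists_residue)
  then show ?thesis using u(2) assms(2) by (intro that[of v]) (auto simp: prism_def algebra_simps)
qed

text \<open>The collection is invariant under lattice translations, so the point can be moved into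
  \<open>prism\<close>. There being exterior puts it into a cell, hence into the Ford region, which
  is translation invariant as well.\<close>

lemma exterior_subset_ford_region:
  assumes "odd p"
  shows "exterior (sphere_collection p \<pi>) \<subseteq> ford_region (Gamma0 \<pi>)"
proof (rule subsetI, clarify)
  fix z t assume ext: "(z, t) \<in> exterior (sphere_collection p \<pi>)"
  have t: "t > 0" by (rule exterior_sphere_collectionD(1)[OF ext])
  obtain v where v: "v \<in> carrier O11" "(z - v, t) \<in> prism" using assms t by (rule prism_cover)
  then obtain j where j: "j \<in> residues" "\<pi> * (z - v) - of_int j \<in> hexagon" by (auto simp: prism_def)
  have "(z - v, t) \<in> domain_cells"
    using t j
  proof (rule in_domain_cellsI)
    fix u assume u: "u \<in> carrier O11" "u \<notin> PIdl\<^bsub>O11\<^esub> \<pi>"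
    have "u + v * \<pi> \<notin> PIdl\<^bsub>O11\<^esub> \<pi>"
    proof
      assume "u + v * \<pi> \<in> PIdl\<^bsub>O11\<^esub> \<pi>"
      then obtain x where "x \<in> carrier O11" "u + v * \<pi> = x * \<pi>" by (auto simp: PIdl_O11_iff)
      then have "x - v \<in> carrier O11" "u = (x - v) * \<pi>" using v(1) by (auto simp: algebra_simps)
      then show False using u(2) PIdl_O11_iff by blast
    qed
    then have "1 \<le> (norm (\<pi> * z - (u + v * \<pi>)))\<^sup>2 + real p * t\<^sup>2"
      using u(1) v(1) by (intro exterior_sphere_collectionD(2)[OF ext]) auto
    then show "1 \<le> (norm (\<pi> * (z - v) - u))\<^sup>2 + real p * t\<^sup>2" by (simp add: algebra_simps)
  next
    fix \<mu> assume "\<mu> \<in> mus"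
    then have "1 / 3 \<le> (norm (\<pi> * z - v * \<pi> - 1 / \<mu>))\<^sup>2 + real p * t\<^sup>2"
      by (rule exterior_sphere_collectionD(3)[OF ext v(1)])
    then show "1 / 3 \<le> (norm (\<pi> * (z - v) - 1 / \<mu>))\<^sup>2 + real p * t\<^sup>2" by (simp add: algebra_simps)
  qed
  then have "(z - v, t) \<in> ford_region (Gamma0 \<pi>)" using domain_cells_subset_ford_region by blast
  from ford_region_translate[OF this v(1)] show "(z, t) \<in> ford_region (Gamma0 \<pi>)" by simp
qed

section \<open>The prism as a fundamental domain of the stabilizer\<close>

lemma closed_prism_cylinder: "closed {(z, t :: real). \<exists>j\<in>residues. \<pi> * z - of_int j \<in> hexagon}"
proof -
  have "{(z, t :: real). \<exists>j\<in>residues. \<pi> * z - of_int j \<in> hexagon} =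
      (\<Union>j\<in>residues. (\<lambda>x. \<pi> * fst x - of_int j) -` hexagon)" by auto
  also have "closed \<dots>"
    by (intro closed_UN ballI closed_vimage closed_hexagon continuous_intros) simp
  finally show ?thesis .
qed

lemma prism_eq: "prism = H3 \<inter> {(z, t). \<exists>j\<in>residues. \<pi> * z - of_int j \<in> hexagon}"
  by (auto simp: prism_def H3_def)

text \<open>Pulling the first point slightly towards the center of its hexagon makes it interior to
  that hexagon, while its translate stays in \<open>prism\<close>. Then a hexagon meets the interior
  of another one, so the two coincide.\<close>

lemma prism_translate_eq:
  assumes "(z, t) \<in> prism" "(z + u, t) \<in> interior prism" "u \<in> carrier O11"
  shows "u = 0"
proof -
  obtain j where j: "j \<in> residues" "\<pi> * z - of_int j \<in> hexagon" using assms(1) by (auto simp: prism_def)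
  define c where "c = of_int j / \<pi> - z"
  obtain e where e: "e > 0" "ball (z + u, t) e \<subseteq> prism"
    using assms(2) mem_interior by blast
  have c: "norm c + 1 > 0" by (simp add: add_nonneg_pos)
  \<comment> \<open>The step \<open>s *\<^sub>R c\<close> stays within the ball of radius
    \<open>e\<close>; the summand \<open>1\<close> covers \<open>c = 0\<close>, and
    \<open>s < 1\<close> keeps the contraction factor \<open>1 - s\<close> positive.\<close>
  define s where "s = min (1 / 2) (e / (norm c + 1))"
  have s: "0 < s" "s < 1" using e(1) c by (auto simp: s_def)
  have "s * norm c \<le> e / (norm c + 1) * norm c" by (intro mult_right_mono) (auto simp: s_def)
  also have "\<dots> < e / (norm c + 1) * (norm c + 1)" using e(1) c by (intro mult_strict_left_mono) auto
  also have "\<dots> = e" using c by simp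
  finally have "dist (z + u, t) (z + u + s *\<^sub>R c, t) < e"
    using s by (simp add: dist_Pair_Pair dist_norm)
  then have "(z + u + s *\<^sub>R c, t) \<in> prism" using e(2) by auto
  then obtain k where k: "k \<in> residues" "\<pi> * (z + u + s *\<^sub>R c) - of_int k \<in> hexagon" by (auto simp: prism_def)
  define w where "w = (1 - s) *\<^sub>R (\<pi> * z - of_int j)"
  have "w \<in> open_hexagon" unfolding w_def using j(2) s by (intro scale_in_open_hexagon) auto
  moreover have "\<pi> * (z + u + s *\<^sub>R c) - of_int k = w - (of_int (k - j) - u * \<pi>)"
    by (simp add: w_def c_def scaleR_conv_of_real field_simps)
  then have "w - (of_int (k - j) - u * \<pi>) \<in> hexagon" using k(2) by (simp only:)
  moreover have "of_int (k - j) - u * \<pi> \<in> carrier O11" using assms(3) by (intro diff_O11 of_int_O11) simp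
  ultimately have "of_int (k - j) - u * \<pi> = 0" by (rule open_hexagon_disjoint)
  then have eq: "of_int k = of_int j + u * \<pi>" by (simp add: algebra_simps)
  with residues_inject[OF k(1) j(1) assms(3)] show ?thesis by simp
qed

text \<open>A frontier point in \<open>H3\<close> lies over a closed hexagon but not over its
  interior, hence over one of its edges; finitely many hyperplanes cover these.\<close>

lemma negligible_frontier_prism: "negligible (frontier prism \<inter> H3)"
proof -
  let ?F = "{1, Complex 1 (sqrt 11), Complex (- 1) (sqrt 11)} \<times> {1 / 2, - 1 / 2, 3, - 3 :: real}"
  \<comment> \<open>Multiplication by \<open>\<pi>\<close> has adjoint multiplication by
    \<open>cnj \<pi>\<close>, so this is the vertical hyperplane over the line
    \<open>n \<bullet> (\<pi> * z - of_int j) = r\<close>.\<close>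
  let ?P = "\<lambda>j (n, r). {x :: complex \<times> real. (cnj \<pi> * n, 0) \<bullet> x = r + n \<bullet> of_int j}"
  have "frontier prism \<inter> H3 \<subseteq> (\<Union>j\<in>residues. \<Union>nr\<in>?F. ?P j nr)"
  proof (rule subsetI, clarify)
    fix z t assume fr: "(z, t) \<in> frontier prism" and H: "(z, t) \<in> H3"
    have "closure prism \<subseteq> {(z, t). \<exists>j\<in>residues. \<pi> * z - of_int j \<in> hexagon}"
      unfolding prism_eq by (intro closure_minimal closed_prism_cylinder) blast
    then obtain j where j: "j \<in> residues" "\<pi> * z - of_int j \<in> hexagon"
      using fr by (auto simp: frontier_def)
    let ?U = "{x :: complex \<times> real. snd x > 0} \<inter> (\<lambda>x. \<pi> * fst x - of_int j) -` open_hexagon"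
    have "open ?U"
      by (intro open_Int open_vimage open_open_hexagon open_Collect_less continuous_intros)
    moreover have "?U \<subseteq> prism"
      using j(1) subsetD[OF open_hexagon_subset]
      by (auto simp: prism_def simp del: atLeastAtMost_iff intro!: bexI[of _ j])
    ultimately have "?U \<subseteq> interior prism" by (intro interior_maximal)
    then have "(z, t) \<notin> ?U" using fr unfolding frontier_def by blast
    then have "\<pi> * z - of_int j \<notin> open_hexagon" using H by (simp add: H3_def)
    then obtain n r where nr: "(n, r) \<in> ?F" "n \<bullet> (\<pi> * z - of_int j) = r"
      using open_hexagon_boundary[OF j(2)] by (metis SigmaI)
    moreover have "(cnj \<pi> * n, 0) \<bullet> (z, t) = n \<bullet> (\<pi> * z)"
      by (simp add: inner_complex_def algebra_simps)
    ultimately have "(z, t) \<in> ?P j (n, r)" by (simp add: inner_diff_right)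
    then show "(z, t) \<in> (\<Union>j\<in>residues. \<Union>nr\<in>?F. ?P j nr)" using j(1) nr(1) by blast
  qed
  moreover have plane: "negligible (?P j nr)" if "nr \<in> ?F" for j nr
  proof -
    obtain n r where nr: "nr = (n, r)" by fastforce
    with that have "n \<noteq> 0" by (auto simp: complex_eq_iff)
    then have "(cnj \<pi> * n, 0 :: real) \<noteq> 0" by (simp add: zero_prod_def)
    then show ?thesis using nr negligible_hyperplane by auto
  qed
  have "negligible (\<Union>nr\<in>?F. ?P j nr)" for j
    by (rule negligible_Union) (simp, erule imageE, simp only: plane)
  then have "negligible (\<Union>j\<in>residues. \<Union>nr\<in>?F. ?P j nr)"
    by (intro negligible_Union) (simp, erule imageE, simp only:)
  ultimately show ?thesis by (rule negligible_subset[rotated])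
qed

lemma fundamental_domain_prism:
  assumes "odd p"
  shows "fundamental_domain (stab_infinity (Gamma0 \<pi>)) prism"
  unfolding fundamental_domain_def
proof (intro conjI ballI impI)
  show "closedin (top_of_set H3) prism"
    unfolding prism_eq by (intro closedin_closed_Int closed_prism_cylinder)
  show "\<exists>A\<in>stab_infinity (Gamma0 \<pi>). act A x \<in> prism" if "x \<in> H3" for x
  proof -
    obtain z t where x: "x = (z, t)" by fastforce
    then have "t > 0" using that by (simp add: H3_def)
    with assms obtain v where "v \<in> carrier O11" "(z - v, t) \<in> prism" by (rule prism_cover)
    then show ?thesis
      by (intro bexI[of _ "translation (- v)"]) (auto simp: x act_translation translation_in_stab)
  qed
  show "act A x = x"
    if x_act: "x \<in> interior prism" "A \<in> stab_infinity (Gamma0 \<pi>)" "act A x \<in> interior prism" for x A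
  proof -
    obtain u where u: "u \<in> carrier O11" "act A = (\<lambda>(z, t). (z + u, t))"
      using x_act(2) by (rule stab_infinity_actE)
    obtain z t where x: "x = (z, t)" by fastforce
    have "u = 0"
      using x_act interior_subset u by (intro prism_translate_eq[of z t u]) (auto simp: x)
    then show ?thesis using u x by simp
  qed
  show "negligible (frontier prism \<inter> H3)" by (rule negligible_frontier_prism)
qed

end

theorem mainTheorem18:
  fixes p :: nat and a b :: int and \<pi> :: complex
  assumes "prime p" and "odd p" and "splits_in_O11 p"
    and "\<pi> = of_int a + of_int b * omega" and "a \<ge> 0" and "b > 0"
    and "of_nat p = \<pi> * cnj \<pi>"
  shows "ford_region (Gamma0 \<pi>) = exterior (sphere_collection p \<pi>) \<and>
    ford_fundamental_domain (Gamma0 \<pi>)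
      (hyp_convex_hull ({Pt 0 0, Infinity} \<union> hexagon_vertices p \<pi> 0) \<union>
       (\<Union>j \<in> {- ((int p - 1) div 2)..(int p - 1) div 2}.
          hyp_convex_hull ({Infinity} \<union> hexagon_vertices p \<pi> j)))"
proof -
  interpret level p a b \<pi> using assms by unfold_locales
  have "ford_region (Gamma0 \<pi>) = exterior (sphere_collection p \<pi>)"
    using ford_region_subset_exterior exterior_subset_ford_region[OF assms(2)] by blast
  \<comment> \<open>The hulls fill exactly the part of the region over \<open>prism\<close>, which
    serves as the fundamental domain of the stabilizer.\<close>
  moreover from this have "domain_cells = ford_region (Gamma0 \<pi>) \<inter> prism"
    using domain_cells_subset_ford_region domain_cells_subset_prism
      exterior_Int_prism_subset_domain_cells by blast
  then have "ford_fundamental_domain (Gamma0 \<pi>) domain_cells"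
    unfolding ford_fundamental_domain_def using fundamental_domain_prism[OF assms(2)] by blast
  ultimately show ?thesis unfolding domain_cells_def by blast
qed

end
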